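(* Let $(\mu_m)_{m\in\mathbb{N}}$ be Borel probability measures on $\mathbb{R}^d$ such that, for every $m\in\mathbb{N}$, the center-outward distribution function $\mathbf{F}^m_\pm$ of $\mu_m$ is continuous. Suppose that $\mu_m$ converges weakly to a Borel probability measure $P$ on $\mathbb{R}^d$, and that the center-outward distribution function $\mathbf{F}_\pm$ of $P$ is also continuous. Then $$\sup_{\mathbf{x}\in\mathbb{R}^d}\left|\mathbf{F}^m_\pm(\mathbf{x})-\mathbf{F}_\pm(\mathbf{x})\right|\longrightarrow 0\quad\text{as } m\to\infty.$$
   Context: $\mathbb{B}_d$ is the open Euclidean unit ball of $\mathbb{R}^d$ centered at $\mathbf{0}$, and $|\cdot|$ is the Euclidean norm. The spherical uniform distribution $\mathrm{U}_d$ is the probability measure on $\mathbb{B}_d$ with Lebesgue density $u_d(\mathbf{x})=\frac{1}{a_d|\mathbf{x}|^{d-1}}$ on $\mathbb{B}_d\setminus\{\mathbf{0}\}$ (and $0$ elsewhere), $a_d=2\pi^{d/2}/\Gamma(d/2)$. Center-outward distribution function of a Borel probability $P$ on $\mathbb{R}^d$: by McCann's theorem there is a convex function $\psi:\mathbb{B}_d\to\mathbb{R}$, unique up to an additive constant (fixed by $\psi(\mathbf{0})=0$), whose a.e.-defined gradient $\nabla\psi$ pushes $\mathrm{U}_d$ forward to $P$. Let $\varphi(\mathbf{x}):=\sup_{|\mathbf{u}|<1}(\langle\mathbf{x},\mathbf{u}\rangle-\psi(\mathbf{u}))$, $\mathbf{x}\in\mathbb{R}^d$, a finite 1-Lipschitz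 convex function. The center-outward distribution function of $P$ is $\mathbf{F}_\pm:=\partial\varphi$ (convex subdifferential), a possibly multivalued map on $\mathbb{R}^d$ with values in $\overline{\mathbb{B}}_d$. "$\mathbf{F}_\pm$ is continuous" means that $\varphi$ is differentiable at every point of $\mathbb{R}^d$, so that $\mathbf{F}_\pm=\nabla\varphi:\mathbb{R}^d\to\overline{\mathbb{B}}_d$ is single-valued and continuous. *)

theory Defs
  imports "HOL-Probability.Probability"
begin

text \<open>Throughout, \<open>\<real>\<^sup>d\<close> is a type of class \<open>euclidean_space\<close> with \<open>d = DIM('a)\<close>. A function on the
  open unit ball is a total function whose values outside \<open>ball 0 1\<close> are never used.\<close>

definition sphere_area :: "nat \<Rightarrow> real" where
  "sphere_area d = 2 * pi powr (real d / 2) / Gamma (real d / 2)"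

definition spherical_uniform :: "'a::euclidean_space measure" where
  "spherical_uniform = density lborel (\<lambda>x::'a. ennreal
     (if x \<in> ball 0 1 - {0} then 1 / (sphere_area DIM('a) * norm x ^ (DIM('a) - 1)) else 0))"

text \<open>The gradient of \<open>\<psi>\<close> is only defined almost everywhere; \<open>T\<close> is an everywhere defined
  Borel version of it. The push-forward \<open>distr\<close> does not depend on the version. By McCann's
  theorem every Borel probability \<open>P\<close> has such a \<open>\<psi>\<close>, and it is unique on \<open>ball 0 1\<close>.\<close>

definition center_outward_potential :: "'a::euclidean_space measure \<Rightarrow> ('a \<Rightarrow> real) \<Rightarrow> bool" where
  "center_outward_potential P \<psi> \<longleftrightarrow>
     convex_on (ball 0 1) \<psi> \<and> \<psi> 0 = 0 \<and>
     (\<exists>T\<in>borel_measurable borel.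
        (AE u in spherical_uniform. GDERIV \<psi> u :> T u) \<and> distr spherical_uniform borel T = P)"

text \<open>For \<open>\<psi>\<close> convex on the ball the supremum is over a set that is bounded above.\<close>

definition ball_conjugate :: "('a::euclidean_space \<Rightarrow> real) \<Rightarrow> 'a \<Rightarrow> real" where
  "ball_conjugate \<psi> x = (SUP u\<in>ball 0 1. x \<bullet> u - \<psi> u)"

definition subdifferential :: "('a::euclidean_space \<Rightarrow> real) \<Rightarrow> 'a \<Rightarrow> 'a set" where
  "subdifferential \<phi> x = {g. \<forall>y. \<phi> x + g \<bullet> (y - x) \<le> \<phi> y}"

text \<open>The center-outward distribution function of the measure with potential \<open>\<psi>\<close>; set-valued.\<close>

definition center_outward_df :: "('a::euclidean_space \<Rightarrow> real) \<Rightarrow> 'a \<Rightarrow> 'a set" where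
  "center_outward_df \<psi> = subdifferential (ball_conjugate \<psi>)"

definition continuous_center_outward_df :: "('a::euclidean_space \<Rightarrow> real) \<Rightarrow> bool" where
  "continuous_center_outward_df \<psi> \<longleftrightarrow> (\<forall>x. ball_conjugate \<psi> differentiable (at x))"

text \<open>The library's \<open>weak_conv_m\<close> covers only measures on the real line.\<close>

definition converges_weakly ::
    "(nat \<Rightarrow> 'a::euclidean_space measure) \<Rightarrow> 'a measure \<Rightarrow> bool" where
  "converges_weakly \<mu> P \<longleftrightarrow>
     (\<forall>f::'a \<Rightarrow> real. continuous_on UNIV f \<and> bounded (range f) \<longrightarrow>
        (\<lambda>m. integral\<^sup>L (\<mu> m) f) \<longlonglongrightarrow> integral\<^sup>L P f)"

end

theory Submission
  imports Defs "HOL-Complex_Analysis.Great_Picard"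
begin

text \<open>The potentials \<open>\<psi>\<^sub>m\<close> are locally equi-Lipschitz by tightness and monotonicity, so by compactness
  it suffices to identify every subsequential limit \<open>k\<close> of them with \<open>\<psi>\<close>.
  McCann's uniqueness argument becomes the following. If \<open>y\<close> is a subgradient of \<open>\<psi>\<^sub>m\<close> at \<open>v\<close> and of \<open>\<psi>\<close>
  at \<open>u\<close>, adding the two subgradient inequalities gives \<open>(\<psi>\<^sub>m - \<psi>)(u) \<ge> (\<psi>\<^sub>m - \<psi>)(v)\<close>. For \<open>v\<close> spherically
  uniform, \<open>y = \<nabla>\<psi>\<^sub>m(v)\<close> and \<open>u = F(y)\<close>, where \<open>F\<close> is the continuous distribution function of \<open>P\<close>, the law
  of \<open>u\<close> tends to the law of \<open>v\<close>, so in the limit equality must hold; hence \<open>k\<close> and \<open>\<psi>\<close> share a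
  subgradient at every point of the ball and differ by a constant. Then the conjugates converge, which
  gives convergence of gradients along bounded sequences of points, while for points tending to
  infinity in a direction \<open>e\<close> monotonicity forces both gradients to tend to \<open>e\<close>.\<close>

section \<open>Subgradients\<close>

text \<open>The inequality is tested only against points of \<open>S\<close>, because a potential
  carries information only on the open ball; \<open>S = UNIV\<close> gives back
  \<open>subdifferential\<close>.\<close>

definition subgrad :: "'a set \<Rightarrow> ('a::euclidean_space \<Rightarrow> real) \<Rightarrow> 'a \<Rightarrow> 'a set" where
  "subgrad S f x = {g. \<forall>y\<in>S. f x + g \<bullet> (y - x) \<le> f y}"

lemma subgradD: "g \<in> subgrad S f x \<Longrightarrow> y \<in> S \<Longrightarrow> f x + g \<bullet> (y - x) \<le> f y"
  by (simp add: subgrad_def)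

text \<open>On the segment from \<open>x\<close> to \<open>y\<close>, convexity bounds every
  difference quotient by \<open>f y - f x\<close>; the quotients tend to the directional derivative
  as the step shrinks to 0.\<close>

lemma GDERIV_in_subgrad:
  fixes f :: "'a::euclidean_space \<Rightarrow> real"
  assumes "convex_on S f" "x \<in> S" "GDERIV f x :> g"
  shows "g \<in> subgrad S f x"
proof -
  have "f x + g \<bullet> (y - x) \<le> f y" if "y \<in> S" for y
  proof -
    have "((\<lambda>t. f (x + t *\<^sub>R (y - x))) has_derivative (\<lambda>h. (h *\<^sub>R (y - x)) \<bullet> g)) (at 0)"
      by (rule has_derivative_compose[where f="\<lambda>t. x + t *\<^sub>R (y - x)" and g=f])
        (use assms(3) in \<open>auto simp: gderiv_def intro!: derivative_eq_intros\<close>)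
    then have "((\<lambda>t. f (x + t *\<^sub>R (y - x))) has_real_derivative (g \<bullet> (y - x))) (at 0)"
      unfolding has_field_derivative_def by (rule has_derivative_eq_rhs) (auto simp: inner_commute)
    then have "((\<lambda>t. (f (x + t *\<^sub>R (y - x)) - f x) / t) \<longlongrightarrow> g \<bullet> (y - x)) (at_right 0)"
      by (auto simp: DERIV_def intro: filterlim_at_split[THEN iffD1, THEN conjunct2])
    moreover have "\<forall>\<^sub>F t in at_right 0. (f (x + t *\<^sub>R (y - x)) - f x) / t \<le> f y - f x"
      unfolding eventually_at_right_field
    proof (intro exI[of _ 1] conjI allI impI)
      fix t :: real assume t: "0 < t" "t < 1"
      have "f ((1 - t) *\<^sub>R x + t *\<^sub>R y) \<le> (1 - t) * f x + t * f y"
        using convex_onD[OF assms(1), of t x y] t assms(2) that by auto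
      moreover have "(1 - t) *\<^sub>R x + t *\<^sub>R y = x + t *\<^sub>R (y - x)"
        by (simp add: algebra_simps)
      ultimately show "(f (x + t *\<^sub>R (y - x)) - f x) / t \<le> f y - f x"
        using t by (simp add: field_simps)
    qed simp
    ultimately have "g \<bullet> (y - x) \<le> f y - f x"
      by (intro tendsto_upperbound) auto
    then show ?thesis by simp
  qed
  then show ?thesis by (simp add: subgrad_def)
qed

text \<open>Move from \<open>x\<close> a distance \<open>e\<close> in the direction of
  \<open>g\<close> itself: the subgradient forces a rise of \<open>e * norm g\<close>, the Lipschitz
  bound allows at most \<open>L * e\<close>.\<close>

lemma subgrad_norm_le:
  fixes f :: "'a::euclidean_space \<Rightarrow> real"
  assumes "L-lipschitz_on T f" "x \<in> interior T" "T \<subseteq> S" "g \<in> subgrad S f x"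
  shows "norm g \<le> L"
proof (cases "g = 0")
  case False
  obtain e where e: "e > 0" "cball x e \<subseteq> T"
    using assms(2) by (meson mem_interior_cball)
  define h where "h = (e / norm g) *\<^sub>R g"
  have nh: "norm h = e" using False e by (simp add: h_def)
  have x: "x + h \<in> T" using e nh by (auto simp: dist_norm)
  have "g \<bullet> h \<le> f (x + h) - f x"
    using subgradD[OF assms(4), of "x + h"] x assms(3) by auto
  also have "\<dots> \<le> L * e"
  proof -
    have "x \<in> T" using e by (meson centre_in_cball less_imp_le subsetD)
    then show ?thesis
      using lipschitz_onD[OF assms(1) x] nh by (fastforce simp: dist_real_def dist_norm)
  qed
  finally have "e * norm g \<le> e * L"
    using False by (simp add: h_def power2_norm_eq_inner[symmetric] power2_eq_square algebra_simps)
  then show ?thesis using e by simp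
qed (use lipschitz_on_nonneg[OF assms(1)] in simp)

text \<open>Closedness of the subgradient relation when function, base point and slope vary
  together. The vanishing error \<open>e\<close> admits approximate subgradients, as they arise in
  \<open>no_common_subgrad_gap\<close>.\<close>

lemma subgrad_limit:
  fixes f :: "nat \<Rightarrow> 'a::euclidean_space \<Rightarrow> real"
  assumes "\<And>n y. y \<in> S \<Longrightarrow> f n (x n) + g n \<bullet> (y - x n) \<le> f n y + e n"
    and "e \<longlonglongrightarrow> 0" "g \<longlonglongrightarrow> g'" "x \<longlonglongrightarrow> x'"
    and "(\<lambda>n. f n (x n)) \<longlonglongrightarrow> f' x'" "\<And>y. y \<in> S \<Longrightarrow> (\<lambda>n. f n y) \<longlonglongrightarrow> f' y"
  shows "g' \<in> subgrad S f' x'"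
  unfolding subgrad_def
proof safe
  fix y assume y: "y \<in> S"
  have "(\<lambda>n. f n y + e n) \<longlonglongrightarrow> f' y + 0"
    using assms y by (intro tendsto_intros) auto
  moreover have "(\<lambda>n. f n (x n) + g n \<bullet> (y - x n)) \<longlonglongrightarrow> f' x' + g' \<bullet> (y - x')"
    using assms by (intro tendsto_intros) auto
  ultimately show "f' x' + g' \<bullet> (y - x') \<le> f' y"
    using assms(1)[OF y] by (auto intro: LIMSEQ_le)
qed

text \<open>Along a subdivision of the segment, a common subgradient controls both increments from either
  side, and the resulting error telescopes.\<close>

lemma common_subgrad_diff_const:
  fixes f k :: "'a::euclidean_space \<Rightarrow> real"
  assumes "convex S" "a \<in> S" "b \<in> S" and common: "\<And>x. x \<in> S \<Longrightarrow> subgrad S f x \<inter> subgrad S k x \<noteq> {}"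
  shows "k a - f a = k b - f b"
proof -
  define D where "D x = k x - f x" for x
  have "\<forall>x\<in>S. \<exists>g. g \<in> subgrad S f x \<and> g \<in> subgrad S k x"
    using common by blast
  then obtain y where y: "\<And>x. x \<in> S \<Longrightarrow> y x \<in> subgrad S f x \<and> y x \<in> subgrad S k x"
    by metis
  have step: "\<bar>D v - D u\<bar> \<le> (y v - y u) \<bullet> (v - u)" if "u \<in> S" "v \<in> S" for u v
    using subgradD[of "y u" S f u v] subgradD[of "y u" S k u v] subgradD[of "y v" S f v u]
      subgradD[of "y v" S k v u] y[OF that(1)] y[OF that(2)] that
    by (simp add: D_def inner_diff_left inner_diff_right)
  define C where "C = (y b - y a) \<bullet> (b - a)"
  have bound: "\<bar>D b - D a\<bar> \<le> C / real n" if n: "n > 0" for n :: nat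
  proof -
    define p where "p i = a + (real i / real n) *\<^sub>R (b - a)" for i
    have p: "p i \<in> S" if "i \<le> n" for i
    proof -
      have "p i = (1 - real i / real n) *\<^sub>R a + (real i / real n) *\<^sub>R b"
        by (simp add: p_def algebra_simps)
      then show ?thesis
        using assms(1-3) that n by (auto simp: convex_alt)
    qed
    have "p (Suc i) - p i = (1 / real n) *\<^sub>R (b - a)" for i
      by (simp add: p_def add_divide_distrib algebra_simps)
    then have *: "\<bar>D (p (Suc i)) - D (p i)\<bar> \<le> (y (p (Suc i)) - y (p i)) \<bullet> ((1 / real n) *\<^sub>R (b - a))" if "i < n" for i
      using step[of "p i" "p (Suc i)"] p that by (metis Suc_leI less_imp_le)
    have "\<bar>D (p n) - D (p 0)\<bar> = \<bar>\<Sum>i<n. D (p (Suc i)) - D (p i)\<bar>"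
      by (simp only: sum_lessThan_telescope[of "\<lambda>i. D (p i)"])
    also have "\<dots> \<le> (\<Sum>i<n. (y (p (Suc i)) - y (p i)) \<bullet> ((1 / real n) *\<^sub>R (b - a)))"
      by (rule order_trans[OF sum_abs sum_mono]) (use * in auto)
    also have "\<dots> = (\<Sum>i<n. y (p (Suc i)) - y (p i)) \<bullet> ((1 / real n) *\<^sub>R (b - a))"
      by (simp only: inner_sum_left)
    also have "\<dots> = C / real n"
      using n unfolding sum_lessThan_telescope[of "\<lambda>i. y (p i)"] by (simp add: C_def p_def)
    finally show ?thesis using n by (simp add: p_def)
  qed
  have "(\<lambda>n. C / real n) \<longlonglongrightarrow> 0"
    by (rule lim_const_over_n)
  then have "\<bar>D b - D a\<bar> \<le> 0"
    by (rule LIMSEQ_le_const) (use bound in \<open>auto intro!: exI[of _ 1]\<close>)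
  then show ?thesis by (simp add: D_def)
qed

section \<open>Locally equi-Lipschitz families on the open ball\<close>

text \<open>Arzela-Ascoli on an open ball: a diagonal subsequence converges on a countable dense
  set, and local equi-Lipschitz bounds carry the Cauchy property to every other point.\<close>

lemma equilipschitz_convergent_subseq:
  fixes f :: "nat \<Rightarrow> 'a::euclidean_space \<Rightarrow> real"
  assumes lip: "\<And>r. r < 1 \<Longrightarrow> \<exists>L. \<forall>m. L-lipschitz_on (cball 0 r) (f m)" and zero: "\<And>m. f m 0 = 0"
  obtains k s where "strict_mono s" "\<And>u. u \<in> ball 0 1 \<Longrightarrow> (\<lambda>m. f (s m) u) \<longlonglongrightarrow> k u"
proof -
  have "\<forall>u\<in>ball (0::'a) 1. \<exists>L. \<forall>m. L-lipschitz_on (cball 0 (norm u)) (f m)"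
    using lip by auto
  then have "\<exists>L. \<forall>u\<in>ball (0::'a) 1. \<forall>m. (L u)-lipschitz_on (cball 0 (norm u)) (f m)"
    by (rule bchoice)
  then obtain L where L: "\<And>(u::'a) m. u \<in> ball 0 1 \<Longrightarrow> (L u)-lipschitz_on (cball 0 (norm u)) (f m)"
    by blast
  have bound: "\<bar>f m u\<bar> \<le> 1 + L u" if "u \<in> ball 0 1" for m u
  proof -
    have "\<bar>f m u - f m 0\<bar> \<le> L u * norm u"
      using lipschitz_onD[OF L[OF that, of m], of u 0] by (auto simp: dist_norm)
    also have "\<dots> \<le> L u"
      using lipschitz_on_nonneg[OF L[OF that, of m]] that by (intro mult_left_le) auto
    finally show ?thesis by (simp add: zero)
  qed
  obtain Q :: "'a set" where Q: "countable Q" "Q \<subseteq> ball 0 1" "ball 0 1 \<subseteq> closure Q"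
    using separable by blast
  \<comment> \<open>The bound on \<open>f m u\<close> depends on \<open>u\<close>; dividing by
    \<open>1 + L u\<close> produces the single bound 1 that the diagonal argument asks for.\<close>
  have "norm (f m u / (1 + L u)) \<le> 1" if "u \<in> Q" for m u
  proof -
    have u: "u \<in> ball 0 1" using that Q by auto
    show ?thesis
      using bound[OF u, of m] lipschitz_on_nonneg[OF L[OF u, of m]] by (simp add: field_simps)
  qed
  with function_convergent_subsequence[OF Q(1), of "\<lambda>m u. f m u / (1 + L u)" 1]
  have "\<exists>s::nat\<Rightarrow>nat. strict_mono s \<and> (\<forall>u\<in>Q. \<exists>l. (\<lambda>m. f (s m) u / (1 + L u)) \<longlonglongrightarrow> l)"
    by metis
  then obtain s where s: "strict_mono (s::nat\<Rightarrow>nat)"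
    "\<And>u. u \<in> Q \<Longrightarrow> \<exists>l. (\<lambda>m. f (s m) u / (1 + L u)) \<longlonglongrightarrow> l"
    by blast
  have "\<exists>l. (\<lambda>m. f (s m) u) \<longlonglongrightarrow> l" if u: "u \<in> ball 0 1" for u
  proof -
    define r where "r = (1 + norm u) / 2"
    have r: "r < 1" "norm u < r" using u by (auto simp: r_def)
    obtain K where K: "\<And>m. K-lipschitz_on (cball 0 r) (f m)"
      using lip[OF r(1)] by blast
    have K0: "K \<ge> 0" using lipschitz_on_nonneg[OF K] .
    have "Cauchy (\<lambda>m. f (s m) u)"
    proof (rule metric_CauchyI)
      fix e :: real assume e: "e > 0"
      \<comment> \<open>The first term makes a move from \<open>u\<close> to \<open>q\<close> cost
        less than \<open>e / 3\<close> (with \<open>K + 1\<close> covering \<open>K = 0\<close>),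
        the second keeps \<open>q\<close> in \<open>cball 0 r\<close>, where \<open>K\<close> is
        valid.\<close>
      define d where "d = min (e / (3 * (K + 1))) (r - norm u)"
      have d: "d > 0" "K * d < e / 3"
      proof -
        show "d > 0" using e K0 r by (simp add: d_def)
        have "K * d \<le> K * (e / (3 * (K + 1)))" using K0 by (intro mult_left_mono) (auto simp: d_def)
        also have "\<dots> < e / 3" using e K0 by (simp add: field_simps)
        finally show "K * d < e / 3" .
      qed
      obtain q where q: "q \<in> Q" "dist q u < d"
        using subsetD[OF Q(3) u] d(1) unfolding closure_approachable by blast
      have "norm q \<le> norm u + dist q u"
        by (metis dist_norm norm_triangle_sub)
      then have qr: "q \<in> cball 0 r" "u \<in> cball 0 r" using q r by (auto simp: d_def)
      have near: "dist (f m u) (f m q) < e / 3" for m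
      proof -
        have "dist (f m u) (f m q) \<le> K * dist u q"
          using lipschitz_onD[OF K] qr by blast
        also have "\<dots> \<le> K * d" using q K0 by (intro mult_left_mono) (auto simp: dist_commute)
        finally show ?thesis using d by simp
      qed
      have nz: "1 + L q \<noteq> 0"
        using lipschitz_on_nonneg[OF L[of q 0]] q Q by force
      obtain l where "(\<lambda>m. f (s m) q / (1 + L q)) \<longlonglongrightarrow> l"
        using s q by blast
      then have "(\<lambda>m. f (s m) q / (1 + L q) * (1 + L q)) \<longlonglongrightarrow> l * (1 + L q)"
        by (intro tendsto_intros)
      then have "Cauchy (\<lambda>m. f (s m) q)"
        using nz by (auto intro: LIMSEQ_imp_Cauchy)
      then obtain M where M: "\<And>m n. m \<ge> M \<Longrightarrow> n \<ge> M \<Longrightarrow> dist (f (s m) q) (f (s n) q) < e / 3"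
        using e by (meson metric_CauchyD divide_pos_pos zero_less_numeral)
      have "dist (f (s m) u) (f (s n) u) < e" if "m \<ge> M" "n \<ge> M" for m n
        using near[of "s m"] near[of "s n"] M[OF that] unfolding dist_real_def by linarith
      then show "\<exists>M. \<forall>m\<ge>M. \<forall>n\<ge>M. dist (f (s m) u) (f (s n) u) < e" by blast
    qed
    then show ?thesis
      by (simp add: Cauchy_convergent_iff convergent_def)
  qed
  then obtain k where "\<And>u. u \<in> ball 0 1 \<Longrightarrow> (\<lambda>m. f (s m) u) \<longlonglongrightarrow> k u" by metis
  with s(1) show ?thesis by (rule that)
qed

lemma lipschitz_on_limit:
  fixes f :: "nat \<Rightarrow> 'a::metric_space \<Rightarrow> 'b::metric_space"
  assumes "\<And>m. L-lipschitz_on T (f m)" "\<And>u. u \<in> T \<Longrightarrow> (\<lambda>m. f m u) \<longlonglongrightarrow> k u"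
  shows "L-lipschitz_on T k"
proof (rule lipschitz_onI)
  fix u v assume "u \<in> T" "v \<in> T"
  then have "(\<lambda>m. dist (f m u) (f m v)) \<longlonglongrightarrow> dist (k u) (k v)"
    using assms(2) by (intro tendsto_intros)
  then show "dist (k u) (k v) \<le> L * dist u v"
    by (rule LIMSEQ_le_const2) (use lipschitz_onD[OF assms(1)] \<open>u \<in> T\<close> \<open>v \<in> T\<close> in auto)
qed (rule lipschitz_on_nonneg[OF assms(1)])

text \<open>Convergence is uniform on a finite net of mesh \<open>d\<close>; the common Lipschitz
  constant, which the limit inherits, covers the points between.\<close>

lemma equilipschitz_uniform_limit:
  fixes f :: "nat \<Rightarrow> 'a::metric_space \<Rightarrow> 'b::metric_space"
  assumes "compact T" "\<And>m. L-lipschitz_on T (f m)" "\<And>u. u \<in> T \<Longrightarrow> (\<lambda>m. f m u) \<longlonglongrightarrow> k u"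
  shows "uniform_limit T f k sequentially"
  unfolding uniform_limit_iff
proof (intro allI impI)
  fix e :: real assume e: "e > 0"
  have L0: "L \<ge> 0" using lipschitz_on_nonneg[OF assms(2)] .
  have k: "L-lipschitz_on T k" by (rule lipschitz_on_limit[OF assms(2,3)])
  define d where "d = e / (3 * (L + 1))"
  have d: "d > 0" "L * d < e / 3" using e L0 by (auto simp: d_def field_simps)
  obtain C where C: "finite C" "C \<subseteq> T" "T \<subseteq> (\<Union>c\<in>C. ball c d)"
  proof (rule compactE_image[OF assms(1), of T "\<lambda>c. ball c d"])
    show "T \<subseteq> (\<Union>c\<in>T. ball c d)" using d by auto
  qed auto
  have "\<forall>\<^sub>F m in sequentially. \<forall>c\<in>C. dist (f m c) (k c) < e / 3"
  proof (rule eventually_ball_finite[OF C(1)], rule ballI)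
    fix c assume "c \<in> C"
    then show "\<forall>\<^sub>F m in sequentially. dist (f m c) (k c) < e / 3"
      using C e by (intro tendstoD[OF assms(3)]) auto
  qed
  then show "\<forall>\<^sub>F m in sequentially. \<forall>u\<in>T. dist (f m u) (k u) < e"
  proof eventually_elim
    case (elim m)
    show ?case
    proof
      fix u assume u: "u \<in> T"
      then obtain c where c: "c \<in> C" "dist c u < d" using C by auto
      then have "c \<in> T" using C by auto
      have "L * dist u c \<le> L * d" "L * dist c u \<le> L * d"
        using c L0 by (auto intro!: mult_left_mono simp: dist_commute)
      then have "dist (f m u) (f m c) < e / 3" "dist (k c) (k u) < e / 3"
        using lipschitz_onD[OF assms(2)[of m] u \<open>c \<in> T\<close>] lipschitz_onD[OF k \<open>c \<in> T\<close> u] d by auto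
      moreover have "dist (f m c) (k c) < e / 3" using elim c by auto
      ultimately show "dist (f m u) (k u) < e"
        by (metis dist_commute dist_triangle_third)
    qed
  qed
qed

text \<open>Index and point move simultaneously. The Lipschitz constant near \<open>x'\<close> is
  the same for all indices, so replacing \<open>x n\<close> by \<open>x'\<close> costs a vanishing
  amount.\<close>

lemma tendsto_equilipschitz:
  fixes f :: "nat \<Rightarrow> 'a::euclidean_space \<Rightarrow> real"
  assumes lip: "\<And>r. r < 1 \<Longrightarrow> \<exists>L. \<forall>m. L-lipschitz_on (cball 0 r) (f m)"
    and lim: "\<And>u. u \<in> ball 0 1 \<Longrightarrow> (\<lambda>m. f m u) \<longlonglongrightarrow> k u"
    and x: "x \<longlonglongrightarrow> x'" "x' \<in> ball 0 1" and M: "filterlim M at_top sequentially"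
  shows "(\<lambda>n. f (M n) (x n)) \<longlonglongrightarrow> k x'"
proof -
  define r where "r = (1 + norm x') / 2"
  have r: "r < 1" "norm x' < r" using x by (auto simp: r_def)
  obtain L where L: "\<And>m. L-lipschitz_on (cball 0 r) (f m)"
    using lip[OF r(1)] by blast
  have "(\<lambda>n. L * dist (x n) x') \<longlonglongrightarrow> 0"
    using x(1) by (auto intro!: tendsto_mult_right_zero simp: tendsto_dist_iff[symmetric])
  moreover have "\<forall>\<^sub>F n in sequentially. norm (f (M n) (x n) - f (M n) x') \<le> L * dist (x n) x'"
  proof -
    have "\<forall>\<^sub>F n in sequentially. norm (x n) < r"
      using tendsto_norm[OF x(1)] r by (simp add: order_tendsto_iff)
    then show ?thesis
    proof eventually_elim
      case (elim n)
      then show ?case using lipschitz_onD[OF L, of "x n" x' "M n"] r by (simp add: dist_real_def)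
    qed
  qed
  ultimately have "(\<lambda>n. f (M n) (x n) - f (M n) x') \<longlonglongrightarrow> 0"
    by (rule Lim_null_comparison[rotated])
  moreover have "(\<lambda>n. f (M n) x') \<longlonglongrightarrow> k x'"
    using filterlim_compose[OF lim[OF x(2)] M] .
  ultimately show ?thesis using tendsto_add by fastforce
qed

text \<open>Slopes at points tending to \<open>u\<close> are bounded by the local Lipschitz
  constant, hence accumulate, and an accumulation point is a subgradient at
  \<open>u\<close>.\<close>

lemma subgrad_ball_nonempty:
  fixes f :: "'a::euclidean_space \<Rightarrow> real"
  assumes lip: "\<And>r. r < 1 \<Longrightarrow> \<exists>L. L-lipschitz_on (cball 0 r) f"
    and dense: "\<And>u e. u \<in> ball 0 1 \<Longrightarrow> e > 0 \<Longrightarrow> \<exists>v\<in>ball 0 1 \<inter> ball u e. subgrad (ball 0 1) f v \<noteq> {}"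
    and u: "u \<in> ball 0 1"
  shows "subgrad (ball 0 1) f u \<noteq> {}"
proof -
  define r where "r = (1 + norm u) / 2"
  have r: "r < 1" "norm u < r" using u by (auto simp: r_def)
  have rb: "cball 0 r \<subseteq> ball (0::'a) 1" using r by auto
  obtain L where L: "L-lipschitz_on (cball 0 r) f"
    using lip[OF r(1)] by blast
  \<comment> \<open>The bound \<open>r - norm u\<close> keeps the approximating points inside
    \<open>cball 0 r\<close>, the other makes them converge to \<open>u\<close>.\<close>
  have "\<exists>v y. dist u v < min (r - norm u) (inverse (Suc n)) \<and> y \<in> subgrad (ball 0 1) f v" for n
    using dense[OF u, of "min (r - norm u) (inverse (Suc n))"] r by auto
  then obtain v y where v: "\<And>n. dist u (v n) < min (r - norm u) (inverse (Suc n))"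
    and y: "\<And>n. y n \<in> subgrad (ball 0 1) f (v n)" by metis
  have vr: "norm (v n) < r" for n
  proof -
    have "norm (v n) \<le> norm u + dist u (v n)"
      by (metis dist_commute dist_norm norm_triangle_sub)
    then show ?thesis using v[of n] by auto
  qed
  have "y n \<in> cball 0 L" for n
    using subgrad_norm_le[OF L _ rb y] vr by auto
  then obtain y' s where s: "strict_mono s" "(y \<circ> s) \<longlonglongrightarrow> y'"
    using compact_cball[of "0::'a" L] unfolding compact_def by metis
  have "(\<lambda>n. dist (v n) u) \<longlonglongrightarrow> 0"
    by (rule Lim_null_comparison[OF _ LIMSEQ_inverse_real_of_nat])
      (use v in \<open>auto simp: dist_commute less_imp_le\<close>)
  then have "v \<longlonglongrightarrow> u" by (simp add: tendsto_dist_iff[symmetric])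
  then have vs: "(v \<circ> s) \<longlonglongrightarrow> u" using s(1) LIMSEQ_subseq_LIMSEQ by blast
  have "y' \<in> subgrad (ball 0 1) f u"
  proof (rule subgrad_limit[of _ "\<lambda>_. f" "v \<circ> s" "y \<circ> s" "\<lambda>_. 0"])
    show "(\<lambda>n. f ((v \<circ> s) n)) \<longlonglongrightarrow> f u"
      using lip by (intro tendsto_equilipschitz[of "\<lambda>_. f" f _ u "\<lambda>n. n", OF _ tendsto_const vs u filterlim_ident]) simp
  qed (use s vs subgradD[OF y] in simp_all)
  then show ?thesis by blast
qed

text \<open>Quantitative form of disjointness: slopes of \<open>h\<close> near \<open>u0\<close>
  fail by a uniform amount to be subgradients of \<open>f m\<close>. Otherwise slopes violating ever
  smaller gaps would accumulate, by compactness, at a common subgradient of \<open>h\<close> and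
  \<open>k\<close>.\<close>

lemma no_common_subgrad_gap:
  fixes f :: "nat \<Rightarrow> 'a::euclidean_space \<Rightarrow> real"
  assumes lip: "\<And>r. r < 1 \<Longrightarrow> \<exists>L. \<forall>m. L-lipschitz_on (cball 0 r) (f m)"
    and lim: "\<And>u. u \<in> ball 0 1 \<Longrightarrow> (\<lambda>m. f m u) \<longlonglongrightarrow> k u"
    and liph: "\<And>r. r < 1 \<Longrightarrow> \<exists>L. L-lipschitz_on (cball 0 r) h"
    and u0: "u0 \<in> ball 0 1" and disj: "subgrad (ball 0 1) h u0 \<inter> subgrad (ball 0 1) k u0 = {}"
  obtains d where "d > 0"
    "\<forall>\<^sub>F m in sequentially. \<forall>u\<in>ball u0 d. \<forall>y\<in>subgrad (ball 0 1) h u.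
       \<exists>w\<in>ball 0 1. f m w + d < f m u + y \<bullet> (w - u)"
proof -
  define r where "r = (1 + norm u0) / 2"
  have r: "r < 1" "norm u0 < r" using u0 by (auto simp: r_def)
  have rb: "cball 0 r \<subseteq> ball (0::'a) 1" using r by auto
  obtain L where L: "L-lipschitz_on (cball 0 r) h"
    using liph[OF r(1)] by blast
  have "\<exists>d>0. \<forall>\<^sub>F m in sequentially. \<forall>u\<in>ball u0 d. \<forall>y\<in>subgrad (ball 0 1) h u.
       \<exists>w\<in>ball 0 1. f m w + d < f m u + y \<bullet> (w - u)"
  proof (rule ccontr)
    assume neg: "\<not> ?thesis"
    have "\<exists>m u y. m \<ge> n \<and> dist u0 u < min (r - norm u0) (inverse (Suc n)) \<and> y \<in> subgrad (ball 0 1) h u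
        \<and> (\<forall>w\<in>ball 0 1. f m u + y \<bullet> (w - u) \<le> f m w + inverse (Suc n))" for n
    proof -
      \<comment> \<open>One number serves as radius and as gap, so a single sequence of values
        \<open>d\<close> yields both the convergence of the points and the vanishing error.\<close>
      define d where "d = min (r - norm u0) (inverse (Suc n))"
      have d: "d > 0" using r by (simp add: d_def)
      have "\<not> (\<forall>\<^sub>F m in sequentially. \<forall>u\<in>ball u0 d. \<forall>y\<in>subgrad (ball 0 1) h u.
       \<exists>w\<in>ball 0 1. f m w + d < f m u + y \<bullet> (w - u))"
        using neg d by blast
      then have "\<exists>\<^sub>F m in sequentially. \<exists>u\<in>ball u0 d. \<exists>y\<in>subgrad (ball 0 1) h u.
       \<forall>w\<in>ball 0 1. f m u + y \<bullet> (w - u) \<le> f m w + d"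
        by (simp add: not_eventually not_less)
      then obtain m u y where *: "m \<ge> n" "u \<in> ball u0 d" "y \<in> subgrad (ball 0 1) h u"
        "\<forall>w\<in>ball 0 1. f m u + y \<bullet> (w - u) \<le> f m w + d"
        unfolding frequently_sequentially by blast
      have "f m u + y \<bullet> (w - u) \<le> f m w + inverse (Suc n)" if "w \<in> ball 0 1" for w
        using *(4) that by (force simp: d_def)
      moreover have "dist u0 u < min (r - norm u0) (inverse (Suc n))"
        using *(2) by (simp add: d_def)
      ultimately show ?thesis using *(1,3) by blast
    qed
    then obtain M v y where M: "\<And>n. M n \<ge> n" and v: "\<And>n. dist u0 (v n) < min (r - norm u0) (inverse (Suc n))"
      and y: "\<And>n. y n \<in> subgrad (ball 0 1) h (v n)"
      and gap: "\<And>n w. w \<in> ball 0 1 \<Longrightarrow> f (M n) (v n) + y n \<bullet> (w - v n) \<le> f (M n) w + inverse (Suc n)"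
      by metis
    have vr: "norm (v n) < r" for n
    proof -
      have "norm (v n) \<le> norm u0 + dist u0 (v n)"
        by (metis dist_commute dist_norm norm_triangle_sub)
      then show ?thesis using v[of n] by auto
    qed
    have "y n \<in> cball 0 L" for n
      using subgrad_norm_le[OF L _ rb y] vr by auto
    then obtain y' s where s: "strict_mono s" "(y \<circ> s) \<longlonglongrightarrow> y'"
      using compact_cball[of "0::'a" L] unfolding compact_def by metis
    have inv0: "(\<lambda>n. inverse (real (Suc n))) \<longlonglongrightarrow> 0"
      by (rule LIMSEQ_inverse_real_of_nat)
    have "(\<lambda>n. dist (v n) u0) \<longlonglongrightarrow> 0"
      by (rule Lim_null_comparison[OF _ inv0]) (use v in \<open>auto simp: dist_commute less_imp_le\<close>)
    then have "v \<longlonglongrightarrow> u0" by (simp add: tendsto_dist_iff[symmetric])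
    then have vs: "(v \<circ> s) \<longlonglongrightarrow> u0" using s(1) LIMSEQ_subseq_LIMSEQ by blast
    \<comment> \<open>The indices \<open>M n\<close> need not be monotone;
      \<open>M n \<ge> n\<close> still sends them to infinity, which is all that the limit lemmas
      require.\<close>
    have Ms: "filterlim (M \<circ> s) at_top sequentially"
      by (rule filterlim_at_top_mono[OF filterlim_subseq[OF s(1)]]) (use M in auto)
    have "y' \<in> subgrad (ball 0 1) h u0"
    proof (rule subgrad_limit[of _ "\<lambda>_. h" "v \<circ> s" "y \<circ> s" "\<lambda>_. 0"])
      show "(\<lambda>n. h ((v \<circ> s) n)) \<longlonglongrightarrow> h u0"
        using liph by (intro tendsto_equilipschitz[of "\<lambda>_. h" h _ u0 "\<lambda>n. n", OF _ tendsto_const vs u0 filterlim_ident]) simp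
    qed (use s vs subgradD[OF y] in simp_all)
    moreover have "y' \<in> subgrad (ball 0 1) k u0"
    proof (rule subgrad_limit[of _ "\<lambda>n. f ((M \<circ> s) n)" "v \<circ> s" "y \<circ> s" "\<lambda>n. inverse (Suc (s n))"])
      show "(\<lambda>n. f ((M \<circ> s) n) ((v \<circ> s) n)) \<longlonglongrightarrow> k u0"
        by (rule tendsto_equilipschitz[OF lip lim vs u0 Ms])
      show "(\<lambda>n. f ((M \<circ> s) n) w) \<longlonglongrightarrow> k w" if "w \<in> ball 0 1" for w
        by (rule filterlim_compose[OF lim[OF that] Ms])
      show "(\<lambda>n. inverse (real (Suc (s n)))) \<longlonglongrightarrow> 0"
        using LIMSEQ_subseq_LIMSEQ[OF inv0 s(1)] by (simp add: o_def)
    qed (use s vs gap in simp_all)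
    ultimately show False using disj by blast
  qed
  then show ?thesis using that by blast
qed

section \<open>Conjugates over the ball\<close>

lemma subdifferential_eq_subgrad: "subdifferential f x = subgrad UNIV f x"
  by (simp add: subdifferential_def subgrad_def)

text \<open>Subtracting the affine function of slope \<open>g\<close> leaves a function with a
  minimum at \<open>x\<close>, so its derivative there is zero and \<open>g\<close> represents the
  derivative of \<open>f\<close>.\<close>

lemma subgrad_UNIV_differentiable_unique:
  fixes f :: "'a::euclidean_space \<Rightarrow> real"
  assumes "f differentiable at x" "g \<in> subgrad UNIV f x" "h \<in> subgrad UNIV f x"
  shows "g = h"
proof -
  obtain f' where f': "(f has_derivative f') (at x)"
    using assms(1) by (auto simp: differentiable_def)
  have *: "f' v = g \<bullet> v" if "g \<in> subgrad UNIV f x" for g v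
  proof -
    have "((\<lambda>y. f y - g \<bullet> (y - x)) has_derivative (\<lambda>v. f' v - g \<bullet> v)) (at x)"
      using f' by (auto intro!: derivative_eq_intros)
    then have "(\<lambda>v. f' v - g \<bullet> v) = (\<lambda>v. 0)"
      by (rule differential_zero_maxmin[where S=UNIV, rotated 2])
        (use subgradD[OF that] in \<open>auto simp: algebra_simps\<close>)
    then show ?thesis by (metis eq_iff_diff_eq_0)
  qed
  have "g \<bullet> v = h \<bullet> v" for v using *[OF assms(2)] *[OF assms(3)] by metis
  then show ?thesis using vector_eq_rdot by blast
qed

lemma differentiable_imp_GDERIV:
  fixes f :: "'a::euclidean_space \<Rightarrow> real"
  assumes "f differentiable at x"
  obtains g where "GDERIV f x :> g"
proof -
  obtain f' where f': "(f has_derivative f') (at x)"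
    using assms by (auto simp: differentiable_def)
  interpret bounded_linear f' using has_derivative_bounded_linear[OF f'] .
  have "f' = (\<lambda>h. h \<bullet> (\<Sum>b\<in>Basis. f' b *\<^sub>R b))"
  proof
    fix h
    have "f' h = f' (\<Sum>b\<in>Basis. (h \<bullet> b) *\<^sub>R b)" by (simp add: euclidean_representation)
    also have "\<dots> = (\<Sum>b\<in>Basis. (h \<bullet> b) * f' b)" by (simp add: sum scaleR)
    finally show "f' h = h \<bullet> (\<Sum>b\<in>Basis. f' b *\<^sub>R b)"
      by (simp add: inner_sum_right mult.commute)
  qed
  then have "GDERIV f x :> (\<Sum>b\<in>Basis. f' b *\<^sub>R b)"
    using f' by (simp add: gderiv_def)
  then show ?thesis by (rule that)
qed

text \<open>Subgradients at every point of the ball stand in for convexity: this is the property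
  from which the conjugate duality below is derived.\<close>

context
  fixes f :: "'a::euclidean_space \<Rightarrow> real"
  assumes nonempty: "\<forall>u\<in>ball 0 1. subgrad (ball 0 1) f u \<noteq> {}"
begin

text \<open>A subgradient at \<open>0\<close> is the slope of an affine minorant of
  \<open>f\<close>, and \<open>u\<close> stays bounded.\<close>

lemma ball_conjugate_bdd: "bdd_above ((\<lambda>u. x \<bullet> u - f u) ` ball 0 1)"
proof -
  obtain g where g: "g \<in> subgrad (ball 0 1) f 0" using nonempty by force
  have "x \<bullet> u - f u \<le> norm x + norm g - f 0" if "u \<in> ball 0 1" for u
  proof -
    have "norm x * norm u \<le> norm x" "norm g * norm u \<le> norm g"
      using that by (auto intro!: mult_left_le)
    then have "x \<bullet> u \<le> norm x" "- (g \<bullet> u) \<le> norm g"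
      using norm_cauchy_schwarz[of x u] norm_cauchy_schwarz[of g "-u"] by auto
    then show ?thesis using subgradD[OF g that] by simp
  qed
  then show ?thesis by (auto intro!: bdd_aboveI2)
qed

lemma ball_conjugate_ge: "u \<in> ball 0 1 \<Longrightarrow> x \<bullet> u - f u \<le> ball_conjugate f x"
  unfolding ball_conjugate_def by (rule cSUP_upper[OF _ ball_conjugate_bdd])

lemma ball_conjugate_le: "(\<And>u. u \<in> ball 0 1 \<Longrightarrow> x \<bullet> u - f u \<le> c) \<Longrightarrow> ball_conjugate f x \<le> c"
  unfolding ball_conjugate_def by (rule cSUP_least) auto

text \<open>Equality case of Young's inequality: rearranged, the subgradient inequality says that
  the supremum is attained at \<open>u\<close>.\<close>

lemma ball_conjugate_eq:
  assumes "u \<in> ball 0 1" "y \<in> subgrad (ball 0 1) f u"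
  shows "ball_conjugate f y = y \<bullet> u - f u"
proof (rule antisym)
  show "ball_conjugate f y \<le> y \<bullet> u - f u"
    by (rule ball_conjugate_le) (use subgradD[OF assms(2)] in \<open>force simp: inner_diff_right\<close>)
qed (rule ball_conjugate_ge[OF assms(1)])

lemma subgrad_ball_conjugateI:
  assumes "u \<in> ball 0 1" "y \<in> subgrad (ball 0 1) f u"
  shows "u \<in> subgrad UNIV (ball_conjugate f) y"
  unfolding subgrad_def
proof safe
  fix z show "ball_conjugate f y + u \<bullet> (z - y) \<le> ball_conjugate f z"
    using ball_conjugate_ge[OF assms(1), of z]
    by (simp add: ball_conjugate_eq[OF assms] inner_diff_right inner_commute)
qed

text \<open>Converse half of the inversion of subdifferentials. It is confined to \<open>u\<close>
  in the open ball; subgradients of the conjugate may also have norm 1.\<close>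

lemma subgrad_ball_conjugateD:
  assumes u: "u \<in> ball 0 1" and y: "u \<in> subgrad UNIV (ball_conjugate f) y"
  shows "y \<in> subgrad (ball 0 1) f u"
proof -
  \<comment> \<open>At a slope \<open>z\<close> of \<open>f\<close> at \<open>u\<close> the
    conjugate is known exactly, so testing at \<open>z\<close> recovers \<open>f u\<close> from the
    conjugate.\<close>
  obtain z where z: "z \<in> subgrad (ball 0 1) f u" using nonempty u by blast
  have "ball_conjugate f y + u \<bullet> (z - y) \<le> z \<bullet> u - f u"
    using subgradD[OF y, of z] ball_conjugate_eq[OF u z] by simp
  then have "f u + y \<bullet> (w - u) \<le> f w" if "w \<in> ball 0 1" for w
    using ball_conjugate_ge[OF that, of y] by (simp add: inner_diff_right inner_commute)
  then show ?thesis by (simp add: subgrad_def)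
qed

lemma ball_conjugate_convex: "convex_on UNIV (ball_conjugate f)"
proof (rule convex_onI)
  fix t :: real and x y :: 'a assume t: "0 < t" "t < 1"
  show "ball_conjugate f ((1 - t) *\<^sub>R x + t *\<^sub>R y) \<le> (1 - t) * ball_conjugate f x + t * ball_conjugate f y"
  proof (rule ball_conjugate_le)
    fix u :: 'a assume u: "u \<in> ball 0 1"
    have "(1 - t) * (x \<bullet> u - f u) + t * (y \<bullet> u - f u) \<le> (1 - t) * ball_conjugate f x + t * ball_conjugate f y"
      using t ball_conjugate_ge[OF u] by (intro add_mono mult_left_mono) auto
    then show "((1 - t) *\<^sub>R x + t *\<^sub>R y) \<bullet> u - f u \<le> (1 - t) * ball_conjugate f x + t * ball_conjugate f y"
      by (simp add: inner_add_left algebra_simps)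
  qed
qed simp

lemma ball_conjugate_lipschitz: "1-lipschitz_on UNIV (ball_conjugate f)"
proof (rule lipschitz_onI)
  have *: "ball_conjugate f x \<le> ball_conjugate f y + dist x y" for x y
  proof (rule ball_conjugate_le)
    fix u :: 'a assume u: "u \<in> ball 0 1"
    have "(x - y) \<bullet> u \<le> norm (x - y) * norm u" by (rule norm_cauchy_schwarz)
    also have "\<dots> \<le> dist x y" using u by (auto simp: dist_norm intro!: mult_left_le)
    finally show "x \<bullet> u - f u \<le> ball_conjugate f y + dist x y"
      using ball_conjugate_ge[OF u, of y] by (simp add: inner_diff_left)
  qed
  show "dist (ball_conjugate f x) (ball_conjugate f y) \<le> 1 * dist x y" for x y
    using *[of x y] *[of y x] by (simp add: dist_real_def dist_commute abs_le_iff)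
qed simp

lemma norm_subgrad_ball_conjugate_le:
  "u \<in> subgrad UNIV (ball_conjugate f) y \<Longrightarrow> norm u \<le> 1"
  by (rule subgrad_norm_le[OF ball_conjugate_lipschitz]) auto

context
  assumes cont: "continuous_center_outward_df f"
begin

text \<open>Gives \<open>the_elem\<close> its meaning: where the conjugate is differentiable its
  gradient is the one and only subgradient.\<close>

lemma center_outward_df_singleton:
  "center_outward_df f y = {the_elem (center_outward_df f y)}"
proof -
  have d: "ball_conjugate f differentiable at y"
    using cont by (simp add: continuous_center_outward_df_def)
  obtain g where "GDERIV (ball_conjugate f) y :> g"
    by (rule differentiable_imp_GDERIV[OF d])
  then have "g \<in> center_outward_df f y"
    using GDERIV_in_subgrad[OF ball_conjugate_convex, of y g]
    by (simp add: center_outward_df_def subdifferential_eq_subgrad)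
  moreover have "h = g" if "h \<in> center_outward_df f y" for h
    using calculation that subgrad_UNIV_differentiable_unique[OF d]
    by (simp add: center_outward_df_def subdifferential_eq_subgrad)
  ultimately have "center_outward_df f y = {g}" by blast
  then show ?thesis by simp
qed

lemma the_elem_center_outward_df_iff:
  "the_elem (center_outward_df f y) = u \<longleftrightarrow> u \<in> subgrad UNIV (ball_conjugate f) y"
  using center_outward_df_singleton[of y]
  by (metis center_outward_df_def singletonD singletonI subdifferential_eq_subgrad)

lemma norm_the_elem_center_outward_df_le: "norm (the_elem (center_outward_df f y)) \<le> 1"
  using the_elem_center_outward_df_iff norm_subgrad_ball_conjugate_le by blast

end

end

section \<open>Potentials of the spherical uniform distribution\<close>

lemma sphere_area_pos: "d > 0 \<Longrightarrow> sphere_area d > 0"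
  by (simp add: sphere_area_def Gamma_real_pos)

lemma spherical_uniform_density_measurable [measurable]:
  "(\<lambda>x::'a::euclidean_space. ennreal
     (if x \<in> ball 0 1 - {0} then 1 / (sphere_area DIM('a) * norm x ^ (DIM('a) - 1)) else 0)) \<in> borel_measurable borel"
  by (intro measurable_compose[OF _ measurable_ennreal] measurable_If borel_measurable_const borel_measurable_divide
    borel_measurable_times borel_measurable_power borel_measurable_norm measurable_ident) auto

lemma sets_spherical_uniform [simp, measurable_cong]: "sets spherical_uniform = sets borel"
  by (simp add: spherical_uniform_def)

lemma space_spherical_uniform [simp]: "space spherical_uniform = UNIV"
  by (simp add: spherical_uniform_def)

lemma AE_spherical_uniform_ball: "AE u in spherical_uniform. u \<in> ball 0 1"
  unfolding spherical_uniform_def by (subst AE_density) (auto simp: ennreal_eq_0_iff)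

text \<open>On the unit ball \<open>norm x ^ (DIM('a) - 1) \<le> 1\<close>, so the density is at
  least \<open>1 / sphere_area DIM('a)\<close> off the origin. Translation invariance makes the
  bound depend on the radius only, not on the centre.\<close>

lemma spherical_uniform_ball_ge:
  fixes c :: "'a::euclidean_space"
  assumes sub: "ball c \<rho> \<subseteq> ball 0 1" and "\<rho> > 0"
  shows "ennreal (measure lborel (ball (0::'a) \<rho>) / sphere_area DIM('a))
    \<le> emeasure spherical_uniform (ball c \<rho>)"
proof -
  let ?a = "sphere_area DIM('a)"
  have a: "?a > 0" by (rule sphere_area_pos) simp
  have eq: "emeasure lborel (ball c \<rho>) = ennreal (measure lborel (ball (0::'a) \<rho>))"
  proof -
    have "measure lborel (ball c \<rho>) = measure lborel (ball (0::'a) \<rho>)"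
      using content_ball_conv_unit_ball[of \<rho> c] content_ball_conv_unit_ball[of \<rho> "0::'a"] assms(2) by simp
    then show ?thesis
      using emeasure_eq_ennreal_measure[of lborel "ball c \<rho>"] emeasure_lborel_ball_finite[of c \<rho>] by auto
  qed
  have "ennreal (measure lborel (ball (0::'a) \<rho>) / ?a) = ennreal (1 / ?a) * emeasure lborel (ball c \<rho>)"
    using a by (simp add: eq ennreal_mult[symmetric])
  \<comment> \<open>The origin, where the density is set to 0, is removed as a null set.\<close>
  also have "emeasure lborel (ball c \<rho>) = emeasure lborel (ball c \<rho> - {0})"
    by (subst emeasure_Diff_null_set) auto
  also have "ennreal (1 / ?a) * \<dots> = (\<integral>\<^sup>+ x. ennreal (1 / ?a) * indicator (ball c \<rho> - {0}) x \<partial>lborel)"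
    by (subst nn_integral_cmult_indicator) auto
  also have "\<dots> \<le> (\<integral>\<^sup>+ x. ennreal (if x \<in> ball 0 1 - {0} then 1 / (?a * norm x ^ (DIM('a) - 1)) else 0)
      * indicator (ball c \<rho>) x \<partial>lborel)"
  proof (rule nn_integral_mono)
    fix x :: 'a
    show "ennreal (1 / ?a) * indicator (ball c \<rho> - {0}) x
      \<le> ennreal (if x \<in> ball 0 1 - {0} then 1 / (?a * norm x ^ (DIM('a) - 1)) else 0) * indicator (ball c \<rho>) x"
    proof (cases "x \<in> ball c \<rho> - {0}")
      case True
      then have x: "x \<in> ball 0 1 - {0}" using sub by auto
      then have "norm x ^ (DIM('a) - 1) \<le> 1" "norm x ^ (DIM('a) - 1) > 0"
        by (auto intro!: power_le_one)
      then have "?a * norm x ^ (DIM('a) - 1) \<le> ?a" "?a * norm x ^ (DIM('a) - 1) > 0"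
        using a by (auto intro: mult_left_le)
      then have "1 / ?a \<le> 1 / (?a * norm x ^ (DIM('a) - 1))"
        by (intro divide_left_mono) (use a in auto)
      then show ?thesis using True x by (simp add: ennreal_leI)
    qed auto
  qed
  also have "\<dots> = emeasure spherical_uniform (ball c \<rho>)"
    unfolding spherical_uniform_def by (subst emeasure_density) auto
  finally show ?thesis .
qed

text \<open>Every ball inside the unit ball has positive mass, so an almost sure property cannot
  fail throughout a nonempty open set.\<close>

lemma AE_spherical_uniform_dense:
  assumes ae: "AE u in spherical_uniform. Q u" and V: "open V" "V \<noteq> {}" "V \<subseteq> ball (0::'a::euclidean_space) 1"
  shows "\<exists>u\<in>V. Q u"
proof (rule ccontr)
  assume neg: "\<not> (\<exists>u\<in>V. Q u)"
  obtain c e where e: "e > 0" "ball c e \<subseteq> V"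
    using V by (metis all_not_in_conv open_contains_ball)
  have "AE u in spherical_uniform. u \<notin> ball c e"
    using ae by eventually_elim (use neg e in auto)
  then have "ball c e \<in> null_sets spherical_uniform"
    by (subst (asm) AE_iff_null) (auto simp: ball_def)
  then have "emeasure spherical_uniform (ball c e) = 0" by blast
  then have "ennreal (measure lborel (ball (0::'a) e) / sphere_area DIM('a)) \<le> 0"
    using spherical_uniform_ball_ge[of c e] e V by simp
  moreover have "measure lborel (ball (0::'a) e) / sphere_area DIM('a) > 0"
    using content_ball_pos[OF e(1)] by (intro divide_pos_pos sphere_area_pos) auto
  ultimately show False
    by (simp add: ennreal_eq_0_iff)
qed

text \<open>Replaces the a.e. gradient by a subgradient, the form in which the transport map
  \<open>T\<close> enters the later arguments.\<close>

lemma center_outward_potential_subgrad: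
  assumes "center_outward_potential P \<psi>"
  obtains T where "T \<in> borel_measurable borel" "distr spherical_uniform borel T = P"
    "AE u in spherical_uniform. u \<in> ball 0 1 \<and> T u \<in> subgrad (ball 0 1) \<psi> u"
proof -
  obtain T where T: "T \<in> borel_measurable borel" "distr spherical_uniform borel T = P"
    "AE u in spherical_uniform. GDERIV \<psi> u :> T u" and c: "convex_on (ball 0 1) \<psi>"
    using assms by (auto simp: center_outward_potential_def)
  from T(3) AE_spherical_uniform_ball
  have "AE u in spherical_uniform. u \<in> ball 0 1 \<and> T u \<in> subgrad (ball 0 1) \<psi> u"
    by eventually_elim (use GDERIV_in_subgrad[OF c] in blast)
  with T(1,2) show ?thesis by (rule that)
qed

text \<open>A push-forward preserves total mass, so the normalisation is inherited from
  \<open>P\<close> and no integration in polar coordinates is required.\<close>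

lemma prob_space_spherical_uniform:
  assumes "center_outward_potential P \<psi>" "prob_space (P :: 'a::euclidean_space measure)"
  shows "prob_space (spherical_uniform :: 'a measure)"
proof -
  obtain T :: "'a \<Rightarrow> 'a" where T: "T \<in> borel_measurable borel" "distr spherical_uniform borel T = P"
    using center_outward_potential_subgrad[OF assms(1)] .
  have [measurable]: "T \<in> measurable spherical_uniform borel" using T(1) by simp
  show ?thesis
    by (rule prob_space_distrD[of T _ borel]) (use T(2) assms(2) in auto)
qed

text \<open>If \<open>g\<close> is a large subgradient at \<open>v\<close>, monotonicity forces large gradients on a whole ball next
  to \<open>v\<close> in the direction of \<open>g\<close>, hence a fixed amount of mass of \<open>P\<close> far away.\<close>

lemma potential_subgrad_bound:
  fixes P :: "'a::euclidean_space measure"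
  assumes pot: "center_outward_potential P \<psi>" and P: "prob_space P"
    and v: "norm v \<le> r" "r < 1" and g: "g \<in> subgrad (ball 0 1) \<psi> v" and R: "R > 0"
    and small: "measure P {y. R \<le> norm y} < measure lborel (ball (0::'a) ((1 - r) / 4)) / sphere_area DIM('a)"
  shows "norm g \<le> 3 * R"
proof (rule ccontr)
  assume "\<not> norm g \<le> 3 * R"
  then have big: "norm g > 3 * R" "norm g > 0" using R by auto
  obtain T where T: "T \<in> borel_measurable borel" "distr spherical_uniform borel T = P"
    "AE u in spherical_uniform. u \<in> ball 0 1 \<and> T u \<in> subgrad (ball 0 1) \<psi> u"
    using center_outward_potential_subgrad[OF pot] .
  interpret U: prob_space "spherical_uniform :: 'a measure"
    by (rule prob_space_spherical_uniform[OF pot P])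
  have [measurable]: "T \<in> measurable spherical_uniform borel" using T(1) by simp
  \<comment> \<open>A ball of radius \<open>\<rho> / 2\<close> around a centre at distance
    \<open>\<rho>\<close> from \<open>v\<close> stays within norm
    \<open>r + 3 * \<rho> / 2 \<le> 1\<close>; its radius is the \<open>(1 - r) / 4\<close> of the
    smallness hypothesis.\<close>
  define \<rho> where "\<rho> = (1 - r) / 2"
  have \<rho>: "\<rho> > 0" using v by (simp add: \<rho>_def)
  define e where "e = (1 / norm g) *\<^sub>R g"
  have e: "norm e = 1" "g \<bullet> e = norm g"
    using big by (auto simp: e_def power2_norm_eq_inner[symmetric] power2_eq_square)
  define c where "c = v + \<rho> *\<^sub>R e"
  have sub: "ball c (\<rho> / 2) \<subseteq> ball 0 1"
  proof
    fix u assume u: "u \<in> ball c (\<rho> / 2)"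
    have "norm u \<le> norm v + norm (\<rho> *\<^sub>R e) + norm (u - c)"
      using norm_triangle_ineq[of "v + \<rho> *\<^sub>R e" "u - c"] norm_triangle_ineq[of v "\<rho> *\<^sub>R e"]
      by (simp add: c_def)
    also have "\<dots> < r + \<rho> + \<rho> / 2"
      using u v e \<rho> by (auto simp: dist_norm norm_minus_commute)
    also have "\<dots> \<le> 1" using v by (simp add: \<rho>_def field_simps)
    finally show "u \<in> ball 0 1" by simp
  qed
  have vb: "v \<in> ball 0 1" using v by auto
  have "AE u in spherical_uniform. u \<in> ball c (\<rho> / 2) \<longrightarrow> R \<le> norm (T u)"
    using T(3)
  proof eventually_elim
    case (elim u)
    show ?case
    proof
      assume u: "u \<in> ball c (\<rho> / 2)"
      define z where "z = u - c"
      have z: "norm z < \<rho> / 2" "u - v = \<rho> *\<^sub>R e + z"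
        using u by (auto simp: z_def c_def dist_norm norm_minus_commute)
      \<comment> \<open>Monotonicity of subgradients, obtained by adding the inequalities at
        \<open>v\<close> and at \<open>u\<close>.\<close>
      have "g \<bullet> (u - v) \<le> T u \<bullet> (u - v)"
        using subgradD[OF g, of u] subgradD[of "T u" "ball 0 1" \<psi> u v] elim vb by (auto simp: inner_diff_right)
      also have "\<dots> \<le> norm (T u) * norm (u - v)" by (rule norm_cauchy_schwarz)
      also have "norm (u - v) \<le> 3 * \<rho> / 2"
        using norm_triangle_ineq[of "\<rho> *\<^sub>R e" z] z e \<rho> by simp
      finally have 1: "g \<bullet> (u - v) \<le> norm (T u) * (3 * \<rho> / 2)"
        by (simp add: mult_left_mono)
      \<comment> \<open>The deviation \<open>z\<close> from the direction of \<open>g\<close> loses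
        at most half of \<open>\<rho> * norm g\<close>; against
        \<open>norm (u - v) \<le> 3 * \<rho> / 2\<close> this gives the factor 3.\<close>
      have "- (g \<bullet> z) \<le> norm g * norm z" using norm_cauchy_schwarz[of g "- z"] by simp
      also have "\<dots> \<le> norm g * (\<rho> / 2)" using z by (intro mult_left_mono) auto
      finally have "norm g * (\<rho> / 2) \<le> g \<bullet> (u - v)"
        using e by (simp add: z(2) inner_add_right algebra_simps)
      with 1 have "\<rho> * norm g \<le> \<rho> * (3 * norm (T u))" by (simp add: algebra_simps)
      then have "norm g \<le> 3 * norm (T u)" using \<rho> by simp
      then show "R \<le> norm (T u)" using big by simp
    qed
  qed
  then have "U.prob (ball c (\<rho> / 2)) \<le> U.prob {u. R \<le> norm (T u)}"
    by (intro U.finite_measure_mono_AE) auto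
  also have "\<dots> = measure P {y. R \<le> norm y}"
    unfolding T(2)[symmetric] by (subst measure_distr) (auto simp: vimage_def)
  also have "\<dots> < measure lborel (ball (0::'a) (\<rho> / 2)) / sphere_area DIM('a)"
    using small by (simp add: \<rho>_def)
  also have "\<dots> \<le> U.prob (ball c (\<rho> / 2))"
    using spherical_uniform_ball_ge[OF sub] \<rho> U.emeasure_eq_measure
    by (simp add: ennreal_le_iff)
  finally show False by simp
qed

text \<open>Slopes on a slightly larger ball are bounded by \<open>3 * R\<close>. They are available
  almost everywhere only, and continuity of \<open>\<psi>\<close> extends the resulting inequality
  to all points.\<close>

lemma potential_lipschitz:
  fixes P :: "'a::euclidean_space measure"
  assumes pot: "center_outward_potential P \<psi>" and P: "prob_space P" and r: "0 \<le> r" "r < 1" and R: "R > 0"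
    and small: "measure P {y. R \<le> norm y} < measure lborel (ball (0::'a) ((1 - r) / 8)) / sphere_area DIM('a)"
  shows "(3 * R)-lipschitz_on (cball 0 r) \<psi>"
proof (rule lipschitz_onI)
  \<comment> \<open>Since \<open>w\<close> may lie on the sphere of radius \<open>r\<close>, an open
    neighbourhood of it needs a larger ball; halving the margin turns \<open>(1 - r') / 4\<close>
    into \<open>(1 - r) / 8\<close>.\<close>
  define r' where "r' = (1 + r) / 2"
  have r': "r < r'" "r' < 1" "(1 - r') / 4 = (1 - r) / 8" using r by (auto simp: r'_def field_simps)
  have "convex_on (ball 0 1) \<psi>" using pot by (simp add: center_outward_potential_def)
  then have "continuous_on (ball 0 1) \<psi>" by (intro convex_on_continuous) auto
  then have cont: "continuous_on (ball 0 r') \<psi>"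
    by (rule continuous_on_subset) (use r' in auto)
  obtain T where T: "AE u in spherical_uniform. u \<in> ball 0 1 \<and> T u \<in> subgrad (ball 0 1) \<psi> u"
    using center_outward_potential_subgrad[OF pot] .
  have *: "\<psi> w \<le> \<psi> u + 3 * R * dist u w" if u: "u \<in> cball 0 r" and w: "w \<in> cball 0 r" for u w
  proof (rule ccontr)
    assume neg: "\<not> ?thesis"
    \<comment> \<open>The points violating the bound for fixed \<open>u\<close> form an open set; if
      nonempty, it contains a \<open>z\<close> with a subgradient, whose norm bound rules the
      violation out.\<close>
    define V where "V = {w \<in> ball 0 r'. \<psi> w - \<psi> u - 3 * R * dist u w \<in> {0<..}}"
    have "open V" unfolding V_def
      by (intro continuous_open_preimage[unfolded vimage_def Int_def mem_Collect_eq] continuous_intros cont) auto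
    moreover have "w \<in> V" using neg w r' by (auto simp: V_def)
    moreover have "V \<subseteq> ball 0 1" using r' by (auto simp: V_def)
    ultimately obtain z where z: "z \<in> V" "T z \<in> subgrad (ball 0 1) \<psi> z"
      using AE_spherical_uniform_dense[OF T, of V] by blast
    have "norm (T z) \<le> 3 * R"
      by (rule potential_subgrad_bound[OF pot P _ r'(2) z(2) R]) (use z small in \<open>auto simp: V_def r'(3)\<close>)
    then have "norm (T z) * norm (z - u) \<le> 3 * R * dist u z"
      by (auto simp: dist_norm norm_minus_commute intro!: mult_right_mono)
    moreover have "T z \<bullet> (z - u) \<le> norm (T z) * norm (z - u)" by (rule norm_cauchy_schwarz)
    ultimately show False
      using subgradD[OF z(2), of u] z(1) u r by (auto simp: V_def inner_diff_right)
  qed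
  show "dist (\<psi> u) (\<psi> w) \<le> 3 * R * dist u w" if "u \<in> cball 0 r" "w \<in> cball 0 r" for u w
    using *[OF that] *[OF that(2,1)] by (simp add: dist_real_def dist_commute abs_le_iff)
qed (use R in simp)

section \<open>Tightness and continuity\<close>

lemma prob_norm_tail:
  fixes P :: "'a::euclidean_space measure"
  assumes "prob_space P" "sets P = sets borel" "e > 0"
  obtains R where "R > 0" "measure P {y. R \<le> norm y} < e"
proof -
  interpret P: prob_space P by fact
  note [measurable_cong] = assms(2)
  define A where "A i = {y::'a. real i \<le> norm y}" for i
  have "(\<Inter>i. A i) = {}"
  proof (rule equals0I)
    fix y assume y: "y \<in> (\<Inter>i. A i)"
    obtain i where "norm y < real i" using reals_Archimedean2 by blast
    moreover have "real i \<le> norm y" using y by (auto simp: A_def)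
    ultimately show False by simp
  qed
  moreover have "(\<lambda>i. measure P (A i)) \<longlonglongrightarrow> measure P (\<Inter>i. A i)"
  proof (rule P.finite_Lim_measure_decseq)
    show "range A \<subseteq> sets P" by (auto simp: A_def assms(2))
    show "decseq A" by (auto simp: A_def decseq_def)
  qed
  ultimately have "(\<lambda>i. measure P (A i)) \<longlonglongrightarrow> 0" by simp
  then have "\<forall>\<^sub>F i in sequentially. measure P (A i) < e"
    using assms(3) by (simp add: order_tendsto_iff)
  then obtain N where "\<And>i. i \<ge> N \<Longrightarrow> measure P (A i) < e"
    by (auto simp: eventually_sequentially)
  then obtain i where "measure P (A i) < e" "i > 0"
    by (metis max.cobounded1 max.cobounded2 less_le_trans zero_less_one)
  then show ?thesis using that[of "real i"] by (simp add: A_def)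
qed

text \<open>A continuous ramp dominating a tail indicator transfers the tail bound from
  \<open>P\<close> to all large \<open>m\<close>; each of the finitely many remaining measures is
  tight by itself.\<close>

lemma converges_weakly_tight:
  fixes P :: "'a::euclidean_space measure"
  assumes \<mu>: "\<And>m. prob_space (\<mu> m)" "\<And>m. sets (\<mu> m) = sets borel"
    and P: "prob_space P" "sets P = sets borel"
    and conv: "converges_weakly \<mu> P" and e: "e > 0"
  obtains R where "R > 0" "\<And>m. measure (\<mu> m) {y. R \<le> norm y} < e"
proof -
  obtain R0 where R0: "R0 > 0" "measure P {y. R0 \<le> norm y} < e"
    using prob_norm_tail[OF P e] .
  \<comment> \<open>The ramp lies between the indicators of \<open>{y. R0 + 1 \<le> norm y}\<close>
    and \<open>{y. R0 \<le> norm y}\<close>.\<close>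
  define f :: "'a \<Rightarrow> real" where "f y = min 1 (max 0 (norm y - R0))" for y
  have f: "continuous_on UNIV f" "bounded (range f)"
  proof -
    show "continuous_on UNIV f" unfolding f_def by (intro continuous_intros)
    show "bounded (range f)" by (rule boundedI[of _ 1]) (auto simp: f_def)
  qed
  have meas: "f \<in> borel_measurable M" if "sets M = sets borel" for M
    using borel_measurable_continuous_onI[OF f(1)] measurable_cong_sets[OF that refl] by auto
  have int: "integrable M f" if "prob_space M" "sets M = sets borel" for M
  proof -
    interpret prob_space M by fact
    show ?thesis
      by (rule integrable_const_bound[of _ 1]) (use meas[OF that(2)] in \<open>auto simp: f_def\<close>)
  qed
  have "integral\<^sup>L P f \<le> integral\<^sup>L P (indicator {y. R0 \<le> norm y})"
  proof (rule integral_mono)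
    interpret prob_space P by fact
    show "integrable P (indicator {y. R0 \<le> norm y} :: 'a \<Rightarrow> real)"
      by (rule integrable_const_bound[of _ 1]) (auto simp: measurable_cong_sets[OF P(2) refl])
  qed (use int[OF P] in \<open>auto simp: f_def indicator_def\<close>)
  also have "\<dots> = measure P {y. R0 \<le> norm y}"
    using sets_eq_imp_space_eq[OF P(2)] by simp
  also have "\<dots> < e" by (rule R0)
  finally have "integral\<^sup>L P f < e" .
  moreover have "(\<lambda>m. integral\<^sup>L (\<mu> m) f) \<longlonglongrightarrow> integral\<^sup>L P f"
    using conv f by (auto simp: converges_weakly_def)
  ultimately have "\<forall>\<^sub>F m in sequentially. integral\<^sup>L (\<mu> m) f < e"
    by (simp add: order_tendsto_iff)
  then obtain N where N: "\<And>m. m \<ge> N \<Longrightarrow> integral\<^sup>L (\<mu> m) f < e"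
    by (auto simp: eventually_sequentially)
  have tail: "measure (\<mu> m) {y. R0 + 1 \<le> norm y} < e" if "m \<ge> N" for m
  proof -
    have "measure (\<mu> m) {y. R0 + 1 \<le> norm y} = integral\<^sup>L (\<mu> m) (indicator {y. R0 + 1 \<le> norm y})"
      using sets_eq_imp_space_eq[OF \<mu>(2)] by simp
    also have "\<dots> \<le> integral\<^sup>L (\<mu> m) f"
    proof (rule integral_mono)
      interpret prob_space "\<mu> m" by fact
      show "integrable (\<mu> m) (indicator {y. R0 + 1 \<le> norm y} :: 'a \<Rightarrow> real)"
        by (rule integrable_const_bound[of _ 1]) (auto simp: measurable_cong_sets[OF \<mu>(2) refl])
    qed (use int[OF \<mu>] in \<open>auto simp: f_def indicator_def\<close>)
    finally show ?thesis using N[OF that] by simp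
  qed
  have "\<exists>R. R > 0 \<and> measure (\<mu> m) {y. R \<le> norm y} < e" for m
    using prob_norm_tail[OF \<mu>(1) \<mu>(2) e, of m] by blast
  then obtain R1 where R1: "\<And>m. R1 m > 0" "\<And>m. measure (\<mu> m) {y. R1 m \<le> norm y} < e"
    by metis
  define R where "R = Max (insert (R0 + 1) (R1 ` {..<N}))"
  have mono: "measure (\<mu> m) {y. R \<le> norm y} < e" if "S \<le> R" "measure (\<mu> m) {y. S \<le> norm y} < e" for S m
  proof -
    interpret prob_space "\<mu> m" by fact
    have "prob {y. R \<le> norm y} \<le> prob {y. S \<le> norm y}"
      by (rule finite_measure_mono) (use that in \<open>auto simp: \<mu>(2)\<close>)
    then show ?thesis using that by simp
  qed
  have ge: "R0 + 1 \<le> R" "\<And>m. m < N \<Longrightarrow> R1 m \<le> R"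
    by (auto simp: R_def intro!: Max_ge)
  show ?thesis
  proof (rule that[of R])
    show "R > 0" using ge(1) R0 by simp
    show "measure (\<mu> m) {y. R \<le> norm y} < e" for m
      by (cases "m < N") (simp_all add: mono[OF ge(2) R1(2)] mono[OF ge(1) tail])
  qed
qed

section \<open>Local Lipschitz bounds and subgradients for potentials\<close>

lemma potentials_equilipschitz:
  fixes P :: "'a::euclidean_space measure"
  assumes \<mu>: "\<And>m. prob_space (\<mu> m)" "\<And>m. sets (\<mu> m) = sets borel"
    and P: "prob_space P" "sets P = sets borel"
    and conv: "converges_weakly \<mu> P" and pot: "\<And>m. center_outward_potential (\<mu> m) (\<psi> m)"
    and r: "r < 1"
  shows "\<exists>L. \<forall>m. L-lipschitz_on (cball 0 r) (\<psi> m)"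
proof -
  \<comment> \<open>A negative \<open>r\<close> is allowed here, while the Lipschitz estimate is for
    nonnegative radii.\<close>
  define s where "s = max r 0"
  have s: "0 \<le> s" "s < 1" "cball 0 r \<subseteq> cball (0::'a) s" using r by (auto simp: s_def)
  have "measure lborel (ball (0::'a) ((1 - s) / 8)) / sphere_area DIM('a) > 0"
    using content_ball_pos[of "(1 - s) / 8" "0::'a"] s by (intro divide_pos_pos sphere_area_pos) auto
  then obtain R where R: "R > 0" "\<And>m. measure (\<mu> m) {y. R \<le> norm y}
      < measure lborel (ball (0::'a) ((1 - s) / 8)) / sphere_area DIM('a)"
    using converges_weakly_tight[OF \<mu> P conv] by blast
  have "(3 * R)-lipschitz_on (cball 0 r) (\<psi> m)" for m
    using potential_lipschitz[OF pot \<mu>(1) s(1,2) R] s(3) by (rule lipschitz_on_subset)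
  then show ?thesis by blast
qed

lemma converges_weakly_const: "converges_weakly (\<lambda>_. P) P"
  by (simp add: converges_weakly_def)

lemma potential_locally_lipschitz:
  fixes P :: "'a::euclidean_space measure"
  assumes "prob_space P" "sets P = sets borel" "center_outward_potential P \<psi>" "r < 1"
  shows "\<exists>L. L-lipschitz_on (cball 0 r) \<psi>"
  using potentials_equilipschitz[of "\<lambda>_. P" P "\<lambda>_. \<psi>" r] assms converges_weakly_const by auto

lemma potential_subgrad_nonempty:
  fixes P :: "'a::euclidean_space measure"
  assumes P: "prob_space P" "sets P = sets borel" "center_outward_potential P \<psi>"
  shows "\<forall>u\<in>ball 0 1. subgrad (ball 0 1) \<psi> u \<noteq> {}"
proof (rule ballI, rule subgrad_ball_nonempty)
  show "\<exists>L. L-lipschitz_on (cball 0 r) \<psi>" if "r < 1" for r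
    by (rule potential_locally_lipschitz[OF P that])
  fix u :: 'a and e :: real assume *: "u \<in> ball 0 1" "e > 0"
  obtain T where T: "AE u in spherical_uniform. u \<in> ball 0 1 \<and> T u \<in> subgrad (ball 0 1) \<psi> u"
    using center_outward_potential_subgrad[OF P(3)] .
  have "ball 0 1 \<inter> ball u e \<noteq> {}" using * by (auto intro!: exI[of _ u])
  then show "\<exists>v\<in>ball 0 1 \<inter> ball u e. subgrad (ball 0 1) \<psi> v \<noteq> {}"
    using AE_spherical_uniform_dense[OF T, of "ball 0 1 \<inter> ball u e"] by blast
qed

text \<open>The slopes lie in the compact unit ball and each accumulation point is a subgradient of
  the limit function, which has only \<open>g'\<close>. With a constant sequence of functions this
  yields continuity of the distribution function.\<close>

lemma subgrad_tendsto:
  fixes \<phi> :: "nat \<Rightarrow> 'a::euclidean_space \<Rightarrow> real"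
  assumes lip: "\<And>n. 1-lipschitz_on UNIV (\<phi> n)" and lim: "\<And>x. (\<lambda>n. \<phi> n x) \<longlonglongrightarrow> \<phi>' x"
    and x: "x \<longlonglongrightarrow> x'" and g: "\<And>n. g n \<in> subgrad UNIV (\<phi> n) (x n)"
    and unique: "\<And>h. h \<in> subgrad UNIV \<phi>' x' \<Longrightarrow> h = g'"
  shows "g \<longlonglongrightarrow> g'"
proof (rule ccontr)
  assume "\<not> g \<longlonglongrightarrow> g'"
  then obtain e where e: "e > 0" "\<not> (\<forall>\<^sub>F n in sequentially. dist (g n) g' < e)"
    by (auto simp: tendsto_iff)
  then have "\<exists>\<^sub>F n in sequentially. e \<le> dist (g n) g'"
    by (simp add: not_eventually not_less)
  then have "infinite {n. e \<le> dist (g n) g'}"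
    by (simp add: frequently_cofinite[symmetric] cofinite_eq_sequentially)
  then obtain s :: "nat \<Rightarrow> nat" where s: "strict_mono s" "\<And>n. e \<le> dist (g (s n)) g'"
    using infinite_enumerate[of "{n. e \<le> dist (g n) g'}"] by auto
  have "norm (g n) \<le> 1" for n
    by (rule subgrad_norm_le[OF lip _ _ g]) auto
  then have "(g \<circ> s) n \<in> cball 0 1" for n by simp
  then obtain h t where t: "strict_mono t" "(g \<circ> s \<circ> t) \<longlonglongrightarrow> h"
    using compact_cball[of "0::'a" 1] unfolding compact_def by metis
  have st: "strict_mono (s \<circ> t)" using s(1) t(1) by (rule strict_mono_o)
  have xst: "(x \<circ> (s \<circ> t)) \<longlonglongrightarrow> x'" by (rule LIMSEQ_subseq_LIMSEQ[OF x st])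
  have "h \<in> subgrad UNIV \<phi>' x'"
  proof (rule subgrad_limit[of _ "\<lambda>n. \<phi> ((s \<circ> t) n)" "x \<circ> (s \<circ> t)" "g \<circ> s \<circ> t" "\<lambda>_. 0"])
    show "(\<lambda>n. \<phi> ((s \<circ> t) n) ((x \<circ> (s \<circ> t)) n)) \<longlonglongrightarrow> \<phi>' x'"
    proof -
      have "(\<lambda>n. dist ((x \<circ> (s \<circ> t)) n) x') \<longlonglongrightarrow> 0"
        using xst by (rule tendsto_dist_iff[THEN iffD1])
      then have "(\<lambda>n. \<phi> ((s \<circ> t) n) ((x \<circ> (s \<circ> t)) n) - \<phi> ((s \<circ> t) n) x') \<longlonglongrightarrow> 0"
        by (rule Lim_null_comparison[rotated])
          (use lipschitz_onD[OF lip] in \<open>auto simp: dist_real_def\<close>)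
      moreover have "(\<lambda>n. \<phi> ((s \<circ> t) n) x') \<longlonglongrightarrow> \<phi>' x'"
        using LIMSEQ_subseq_LIMSEQ[OF lim st] by (simp add: o_def)
      ultimately show ?thesis using tendsto_add by fastforce
    qed
    show "(\<lambda>n. \<phi> ((s \<circ> t) n) y) \<longlonglongrightarrow> \<phi>' y" for y
      using LIMSEQ_subseq_LIMSEQ[OF lim st] by (simp add: o_def)
      show "\<phi> ((s \<circ> t) n) ((x \<circ> (s \<circ> t)) n) + (g \<circ> s \<circ> t) n \<bullet> (y - (x \<circ> (s \<circ> t)) n) \<le> \<phi> ((s \<circ> t) n) y + 0" for n y
      using subgradD[OF g, of y "s (t n)"] by simp
    show "(x \<circ> (s \<circ> t)) \<longlonglongrightarrow> x'" by (rule xst)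
  qed (use t in simp_all)
  then have "h = g'" by (rule unique)
  moreover have "(\<lambda>n. dist ((g \<circ> s \<circ> t) n) g') \<longlonglongrightarrow> dist h g'"
    using t(2) by (intro tendsto_intros)
  then have "e \<le> dist h g'"
    by (rule LIMSEQ_le_const) (use s(2) in auto)
  ultimately show False using e(1) by simp
qed

section \<open>The distribution function as a continuous map\<close>

lemma continuous_the_elem_center_outward_df:
  fixes f :: "'a::euclidean_space \<Rightarrow> real"
  assumes nonempty: "\<forall>u\<in>ball 0 1. subgrad (ball 0 1) f u \<noteq> {}"
    and cont: "continuous_center_outward_df f"
  shows "continuous_on UNIV (\<lambda>y. the_elem (center_outward_df f y))"
  unfolding continuous_on_sequentially
proof safe
  fix x :: "nat \<Rightarrow> 'a" and a assume x: "x \<longlonglongrightarrow> a"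
  show "((\<lambda>y. the_elem (center_outward_df f y)) \<circ> x) \<longlonglongrightarrow> the_elem (center_outward_df f a)"
  proof (rule subgrad_tendsto[of "\<lambda>_. ball_conjugate f", OF _ tendsto_const x])
    show "1-lipschitz_on UNIV (ball_conjugate f)" by (rule ball_conjugate_lipschitz[OF nonempty])
    show "((\<lambda>y. the_elem (center_outward_df f y)) \<circ> x) n \<in> subgrad UNIV (ball_conjugate f) (x n)" for n
      unfolding o_def by (rule the_elem_center_outward_df_iff[OF nonempty cont, THEN iffD1, OF refl])
    show "h = the_elem (center_outward_df f a)" if "h \<in> subgrad UNIV (ball_conjugate f) a" for h
      by (rule the_elem_center_outward_df_iff[OF nonempty cont, THEN iffD2, OF that, symmetric])
  qed
qed

text \<open>The distribution function inverts the transport map \<open>T\<close> almost everywhere,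
  so it carries \<open>P\<close> back to the spherical uniform law.\<close>

lemma center_outward_df_pushforward:
  fixes P :: "'a::euclidean_space measure" and g :: "'a \<Rightarrow> real"
  assumes P: "prob_space P" "sets P = sets borel" "center_outward_potential P \<psi>"
    and cont: "continuous_center_outward_df \<psi>" and g: "g \<in> borel_measurable borel"
  shows "integral\<^sup>L P (\<lambda>y. g (the_elem (center_outward_df \<psi> y))) = integral\<^sup>L spherical_uniform g"
proof -
  define F where "F y = the_elem (center_outward_df \<psi> y)" for y
  note nonempty = potential_subgrad_nonempty[OF P]
  have [measurable]: "F \<in> borel_measurable borel" unfolding F_def
    by (intro borel_measurable_continuous_onI continuous_the_elem_center_outward_df nonempty cont)
  note [measurable] = g
  obtain T where T: "T \<in> borel_measurable borel" "distr spherical_uniform borel T = P"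
    "AE u in spherical_uniform. u \<in> ball 0 1 \<and> T u \<in> subgrad (ball 0 1) \<psi> u"
    using center_outward_potential_subgrad[OF P(3)] .
  have [measurable]: "T \<in> measurable spherical_uniform borel" using T(1) by simp
  have "integral\<^sup>L P (\<lambda>y. g (F y)) = integral\<^sup>L spherical_uniform (\<lambda>u. g (F (T u)))"
    unfolding T(2)[symmetric] by (subst integral_distr) auto
  also have "\<dots> = integral\<^sup>L spherical_uniform g"
  proof (rule integral_cong_AE)
    show "AE u in spherical_uniform. g (F (T u)) = g u"
      using T(3)
    proof eventually_elim
      case (elim u)
      then have "u \<in> subgrad UNIV (ball_conjugate \<psi>) (T u)"
        using subgrad_ball_conjugateI[OF nonempty] by blast
      then have "F (T u) = u"
        unfolding F_def by (rule the_elem_center_outward_df_iff[OF nonempty cont, THEN iffD2])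
      then show ?case by simp
    qed
  qed auto
  finally show ?thesis by (simp add: F_def)
qed

section \<open>Identification of limit potentials\<close>

text \<open>A point without common subgradient would make the increase of \<open>\<psi>\<^sub>m - \<psi>\<close> at least \<open>d\<close> on a set of
  positive mass (detected by the bump \<open>\<beta>\<close>), whereas the mean of the clipped difference \<open>\<kappa> \<circ> D\<close> is
  asymptotically invariant; the cutoff \<open>\<eta>\<close> keeps the test function continuous up to the sphere.\<close>

lemma common_subgrad_of_limit:
  fixes P :: "'a::euclidean_space measure" and u0 :: 'a
  assumes \<mu>: "\<And>m. prob_space (\<mu> m)" "\<And>m. sets (\<mu> m) = sets borel"
    and P: "prob_space P" "sets P = sets borel" "center_outward_potential P \<psi>"
    and conv: "converges_weakly \<mu> P" and pot: "\<And>m. center_outward_potential (\<mu> m) (\<psi>' m)"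
    and cont: "continuous_center_outward_df \<psi>"
    and lim: "\<And>u. u \<in> ball 0 1 \<Longrightarrow> (\<lambda>m. \<psi>' m u) \<longlonglongrightarrow> k u"
    and u0: "u0 \<in> ball 0 1"
  shows "subgrad (ball 0 1) \<psi> u0 \<inter> subgrad (ball 0 1) k u0 \<noteq> {}"
proof
  assume disj: "subgrad (ball 0 1) \<psi> u0 \<inter> subgrad (ball 0 1) k u0 = {}"
  note lip = potentials_equilipschitz[OF \<mu> P(1,2) conv pot]
  note lip\<psi> = potential_locally_lipschitz[OF P]
  note nonempty = potential_subgrad_nonempty[OF P]
  obtain d where d: "d > 0" and gap: "\<forall>\<^sub>F m in sequentially. \<forall>u\<in>ball u0 d. \<forall>y\<in>subgrad (ball 0 1) \<psi> u.
       \<exists>w\<in>ball 0 1. \<psi>' m w + d < \<psi>' m u + y \<bullet> (w - u)"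
    using no_common_subgrad_gap[OF lip lim lip\<psi> u0 disj] by blast
  interpret U: prob_space "spherical_uniform :: 'a measure"
    by (rule prob_space_spherical_uniform[OF P(3,1)])
  define F where "F y = the_elem (center_outward_df \<psi> y)" for y
  have contF: "continuous_on UNIV F" unfolding F_def
    by (rule continuous_the_elem_center_outward_df[OF nonempty cont])
  define D where "D u = k u - \<psi> u" for u
  have contD: "continuous_on (ball 0 1) D"
  proof (rule continuous_at_imp_continuous_on, rule ballI)
    fix u :: 'a assume u: "u \<in> ball 0 1"
    define r where "r = (1 + norm u) / 2"
    have r: "r < 1" "norm u < r" using u by (auto simp: r_def)
    obtain L where L: "\<And>m. L-lipschitz_on (cball 0 r) (\<psi>' m)" using lip[OF r(1)] by blast
    have "L-lipschitz_on (cball 0 r) k"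
      by (rule lipschitz_on_limit[OF L lim]) (use r in auto)
    moreover obtain L' where "L'-lipschitz_on (cball 0 r) \<psi>" using lip\<psi>[OF r(1)] by blast
    ultimately have "continuous_on (cball 0 r) D" unfolding D_def
      by (intro continuous_intros lipschitz_on_continuous_on)
    then have "continuous_on (ball 0 r) D" by (rule continuous_on_subset) auto
    then show "isCont D u"
      using r by (simp add: continuous_on_eq_continuous_at)
  qed
  define a where "a = D u0"
  obtain \<delta>1 where \<delta>1: "\<delta>1 > 0" "\<And>u. u \<in> ball 0 1 \<Longrightarrow> dist u u0 < \<delta>1 \<Longrightarrow> dist (D u) (D u0) < d / 8"
    using contD u0 d unfolding continuous_on_iff by (metis divide_pos_pos zero_less_numeral)
  define r0 where "r0 = (1 + norm u0) / 2"
  have r0: "r0 < 1" "norm u0 < r0" using u0 by (auto simp: r0_def)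
  \<comment> \<open>Three demands: the gap applies within \<open>d\<close>, \<open>D\<close> varies
    by less than \<open>d / 8\<close> within \<open>\<delta>1\<close>, and the support of the bump
    stays where \<open>norm u \<le> r0\<close>.\<close>
  define \<delta> where "\<delta> = min (min d \<delta>1) (r0 - norm u0)"
  have \<delta>: "\<delta> > 0" "\<delta> \<le> d" "\<delta> \<le> \<delta>1" using d \<delta>1 r0 by (auto simp: \<delta>_def)
  have in_r0: "norm u < r0" if "dist u u0 < \<delta>" for u
  proof -
    have "norm u \<le> norm u0 + dist u u0" by (metis dist_norm norm_triangle_sub)
    then show ?thesis using that by (simp add: \<delta>_def)
  qed
  define \<beta> where "\<beta> u = max 0 (1 - dist u u0 / \<delta>)" for u
  have \<beta>: "0 \<le> \<beta> u" "\<beta> u \<le> 1" "\<beta> u \<noteq> 0 \<longleftrightarrow> dist u u0 < \<delta>" for u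
    using \<delta> by (auto simp: \<beta>_def max_def field_simps)
  have cont\<beta>: "continuous_on UNIV \<beta>" unfolding \<beta>_def using \<delta> by (intro continuous_intros) auto
  have bint: "integrable spherical_uniform g"
    if "continuous_on UNIV g" "\<And>u. \<bar>g u\<bar> \<le> C" for g :: "'a \<Rightarrow> real" and C
    by (rule U.integrable_const_bound[of _ C])
      (use that borel_measurable_continuous_onI[OF that(1)] in auto)
  note int\<beta> = bint[OF cont\<beta>, of 1]
  define b where "b = integral\<^sup>L spherical_uniform \<beta>"
  have b: "b > 0"
  proof (rule ccontr)
    assume "\<not> b > 0"
    moreover have "b \<ge> 0" unfolding b_def by (rule integral_nonneg_AE) (use \<beta> in auto)
    ultimately have "b = 0" by simp
    then have "AE u in spherical_uniform. \<beta> u = 0"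
      using integral_nonneg_eq_0_iff_AE[OF int\<beta>] \<beta> by (simp add: b_def)
    then obtain u where "u \<in> ball u0 \<delta>" "\<beta> u = 0"
      using AE_spherical_uniform_dense[of "\<lambda>u. \<beta> u = 0" "ball u0 \<delta>"] \<delta>(1) in_r0 r0
      by (force simp: dist_commute)
    then show False using \<beta>(3)[of u] by (simp add: dist_commute)
  qed
  \<comment> \<open>For \<open>j > 0\<close> this vanishes where
    \<open>norm u \<ge> 1 - 1 / j\<close>, and it tends to 1 on the open ball, so dominated
    convergence makes the mean of \<open>1 - \<eta>' j u\<close> as small as desired.\<close>
  define \<eta>' where "\<eta>' j u = min 1 (max 0 (real j * (1 - norm u) - 1))" for j :: nat and u :: 'a
  have cont\<eta>': "continuous_on UNIV (\<eta>' j)" for j unfolding \<eta>'_def by (intro continuous_intros)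
  have "(\<lambda>j. integral\<^sup>L spherical_uniform (\<lambda>u. 1 - \<eta>' j u)) \<longlonglongrightarrow> integral\<^sup>L spherical_uniform (\<lambda>u::'a. 0::real)"
  proof (rule integral_dominated_convergence[where w="\<lambda>_. 1"])
    show "(\<lambda>u. 1 - \<eta>' j u) \<in> borel_measurable spherical_uniform" for j
      using borel_measurable_continuous_onI[OF cont\<eta>'[of j]] by simp
    show "AE u in spherical_uniform. (\<lambda>j. 1 - \<eta>' j u) \<longlonglongrightarrow> 0"
      using AE_spherical_uniform_ball
    proof eventually_elim
      case (elim u)
      then have "1 - norm u > 0" by simp
      have "\<forall>\<^sub>F j in sequentially. 2 / (1 - norm u) \<le> real j"
        by (rule filterlim_real_sequentially[unfolded filterlim_at_top, rule_format])
      then have "\<forall>\<^sub>F j in sequentially. 1 - \<eta>' j u = 0"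
        by eventually_elim (use \<open>1 - norm u > 0\<close> in \<open>simp add: \<eta>'_def field_simps\<close>)
      then show ?case by (rule tendsto_eventually)
    qed
    show "AE u in spherical_uniform. norm (1 - \<eta>' j u) \<le> 1" for j by (simp add: \<eta>'_def)
  qed auto
  then have "(\<lambda>j. integral\<^sup>L spherical_uniform (\<lambda>u. 1 - \<eta>' j u)) \<longlonglongrightarrow> 0" by simp
  then have "\<forall>\<^sub>F j in sequentially. integral\<^sup>L spherical_uniform (\<lambda>u. 1 - \<eta>' j u) < b / 8"
    by (rule order_tendstoD(2)) (use b in simp)
  moreover have "\<forall>\<^sub>F j in sequentially. 1 / (1 - r0) \<le> real j"
    by (rule filterlim_real_sequentially[unfolded filterlim_at_top, rule_format])
  moreover have "\<forall>\<^sub>F j in sequentially. j > (0::nat)"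
    by (rule eventually_gt_at_top)
  ultimately have "\<forall>\<^sub>F j in sequentially. integral\<^sup>L spherical_uniform (\<lambda>u. 1 - \<eta>' j u) < b / 8 \<and>
      1 / (1 - r0) \<le> real j \<and> j > 0"
    by eventually_elim auto
  then obtain j where j: "integral\<^sup>L spherical_uniform (\<lambda>u. 1 - \<eta>' j u) < b / 8" "1 / (1 - r0) \<le> real j" "j > 0"
    by (auto simp: eventually_sequentially)
  define \<eta> where "\<eta> = \<eta>' j"
  define r where "r = 1 - 1 / real j"
  have r: "r < 1" "r0 \<le> r" using j r0 by (auto simp: r_def field_simps)
  have \<eta>: "0 \<le> \<eta> u" "\<eta> u \<le> 1" "norm u \<ge> r \<Longrightarrow> \<eta> u = 0" for u
    using j(3) by (auto simp: \<eta>_def \<eta>'_def r_def field_simps)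
  have cont\<eta>: "continuous_on UNIV \<eta>" unfolding \<eta>_def by (rule cont\<eta>')
  \<comment> \<open>Clips values to the window from \<open>a - d\<close> to \<open>a + d\<close> and
    shifts it to start at 0. The result is bounded, monotone and 1-Lipschitz, yet an increase by
    about \<open>d\<close> near the level \<open>a\<close> remains visible.\<close>
  define \<kappa> where "\<kappa> t = min (2 * d) (max 0 (t - a + d))" for t
  define f where "f u = (if u \<in> ball 0 1 then \<eta> u * \<kappa> (D u) else 0)" for u
  have \<kappa>: "0 \<le> \<kappa> t" "\<kappa> t \<le> 2 * d" "s \<le> t \<Longrightarrow> \<kappa> s \<le> \<kappa> t" "\<kappa> s \<le> \<kappa> t + \<bar>s - t\<bar>" for s t
    using d by (auto simp: \<kappa>_def)
  have f: "0 \<le> f u" "f u \<le> 2 * d" for u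
  proof -
    have "\<eta> u * \<kappa> (D u) \<le> 1 * (2 * d)" using \<eta> \<kappa> by (intro mult_mono) auto
    then show "0 \<le> f u" "f u \<le> 2 * d" using \<eta> \<kappa> d by (auto simp: f_def)
  qed
  have contf: "continuous_on UNIV f"
  proof -
    have "continuous_on (ball 0 1) (\<lambda>u. \<eta> u * \<kappa> (D u))" unfolding \<kappa>_def
      by (intro continuous_intros contD continuous_on_subset[OF cont\<eta>]) auto
    then have "continuous_on (ball 0 1) f"
      by (rule continuous_on_eq) (simp add: f_def)
    moreover have "continuous_on (- cball 0 r) f"
      by (rule continuous_on_eq[OF continuous_on_const[of _ 0]]) (use \<eta> in \<open>auto simp: f_def\<close>)
    ultimately have "continuous_on (ball 0 1 \<union> - cball 0 r) f"
      by (intro continuous_on_open_Un) auto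
    moreover have "ball 0 1 \<union> - cball 0 r = (UNIV :: 'a set)" using r by auto
    ultimately show ?thesis by simp
  qed
  \<comment> \<open>The bound \<open>d / 8\<close> serves the jump estimate below;
    \<open>d * b / 16\<close> serves the final balance, where
    \<open>d * b / 4 - d * b / 2 + 2 * \<sigma>\<close> must be negative.\<close>
  define \<sigma> where "\<sigma> = min (d / 8) (d * b / 16)"
  have \<sigma>: "\<sigma> > 0" "\<sigma> \<le> d / 8" "\<sigma> \<le> d * b / 16" using d b by (auto simp: \<sigma>_def)
  \<comment> \<open>A continuous majorant of the transported test function:
    \<open>2 * d * (1 - \<eta> u)\<close> pays for the cutoff at \<open>u\<close>, and
    \<open>d / 2 * \<beta> u\<close> records the strict gain near \<open>u0\<close>.\<close>
  define G where "G u = f u + 2 * d * (1 - \<eta> u) - d / 2 * \<beta> u" for u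
  have contG: "continuous_on UNIV G" unfolding G_def
    by (intro continuous_intros contf cont\<eta> cont\<beta>)
  have bG: "\<bar>G u\<bar> \<le> 5 * d" for u
  proof -
    have "0 \<le> d * (1 - \<eta> u)" "d * (1 - \<eta> u) \<le> d" "0 \<le> d * \<beta> u" "d * \<beta> u \<le> d"
      using d \<eta>[of u] \<beta>[of u] by (auto intro: mult_left_le)
    then show ?thesis using f[of u] by (simp add: G_def abs_le_iff)
  qed
  obtain L where L: "\<And>m. L-lipschitz_on (cball 0 r) (\<psi>' m)" using lip[OF r(1)] by blast
  have "uniform_limit (cball 0 r) \<psi>' k sequentially"
    by (rule equilipschitz_uniform_limit[OF compact_cball L lim]) (use r in auto)
  then have "\<forall>\<^sub>F m in sequentially. \<forall>u\<in>cball 0 r. dist (\<psi>' m u) (k u) < \<sigma>"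
    using \<sigma>(1) by (auto simp: uniform_limit_iff)
  then have ev: "\<forall>\<^sub>F m in sequentially. integral\<^sup>L spherical_uniform f \<le> integral\<^sup>L (\<mu> m) (\<lambda>y. G (F y)) + 2 * \<sigma>"
    using gap
  proof eventually_elim
    case (elim m)
    define Dm where "Dm u = \<psi>' m u - \<psi> u" for u
    have near: "\<bar>Dm u - D u\<bar> \<le> \<sigma>" if "norm u \<le> r" for u
      using elim(1) that by (force simp: Dm_def D_def dist_real_def)
    obtain T where T: "T \<in> borel_measurable borel" "distr spherical_uniform borel T = \<mu> m"
      "AE v in spherical_uniform. v \<in> ball 0 1 \<and> T v \<in> subgrad (ball 0 1) (\<psi>' m) v"
      using center_outward_potential_subgrad[OF pot] .
    have [measurable]: "T \<in> measurable spherical_uniform borel" using T(1) by simp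
    have [measurable]: "G \<in> borel_measurable borel" "F \<in> borel_measurable borel" "f \<in> borel_measurable borel"
      by (rule borel_measurable_continuous_onI; fact)+
    \<comment> \<open>The errors \<open>\<sigma>\<close> come from passing from \<open>D\<close> to
      \<open>Dm\<close> at \<open>v\<close> and back from \<open>Dm\<close> to \<open>D\<close> at
      \<open>u\<close>.\<close>
    have key: "f v \<le> G (F y) + 2 * \<sigma>" if v: "v \<in> ball 0 1" and y: "y \<in> subgrad (ball 0 1) (\<psi>' m) v" for v y
    proof -
      define u where "u = F y"
      have fv: "f v \<le> \<kappa> (Dm v) + \<sigma>"
      proof (cases "norm v \<le> r")
        case True
        have "f v \<le> 1 * \<kappa> (D v)" unfolding f_def using \<eta> \<kappa> by (auto intro!: mult_left_le_one_le)
        then show ?thesis using \<kappa>(4)[of "D v" "Dm v"] near[OF True] by simp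
      next
        case False
        then show ?thesis using \<eta>(3)[of v] \<kappa>(1) \<sigma>(1) by (auto simp: f_def add_nonneg_nonneg)
      qed
      show ?thesis
      proof (cases "norm u \<le> r")
        case True
        then have u: "u \<in> ball 0 1" using r by simp
        have "u \<in> subgrad UNIV (ball_conjugate \<psi>) y"
          unfolding u_def F_def by (rule the_elem_center_outward_df_iff[OF nonempty cont, THEN iffD1, OF refl])
        then have yu: "y \<in> subgrad (ball 0 1) \<psi> u" by (rule subgrad_ball_conjugateD[OF nonempty u])
        have incr: "Dm v \<le> Dm u"
          using subgradD[OF yu v] subgradD[OF y u] by (simp add: Dm_def inner_diff_right)
        have "\<kappa> (Dm v) + d / 2 * \<beta> u \<le> \<kappa> (Dm u)"
        proof (cases "\<beta> u = 0")
          case True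
          then show ?thesis using \<kappa>(3)[OF incr] by simp
        next
          case False
          then have du: "dist u u0 < \<delta>" using \<beta>(3) by simp
          then have "u \<in> ball u0 d" using \<delta> by (simp add: dist_commute)
          then obtain w where w: "w \<in> ball 0 1" "\<psi>' m w + d < \<psi>' m u + y \<bullet> (w - u)"
            using elim(2) yu by blast
          \<comment> \<open>Testing \<open>y\<close> at the witness \<open>w\<close> instead of at
            \<open>u\<close> brings the gap \<open>d\<close> into the sum of the two subgradient
            inequalities.\<close>
          have "Dm v \<le> Dm u - d"
            using subgradD[OF yu v] subgradD[OF y w(1)] w(2) by (simp add: Dm_def inner_diff_right)
          moreover have "\<bar>D u - a\<bar> < d / 8"
            using \<delta>1(2)[OF u] du \<delta> by (simp add: a_def dist_real_def)
          ultimately have "Dm u \<ge> a - d / 4" "Dm v \<le> a - 3 * d / 4"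
            using near[OF \<open>norm u \<le> r\<close>] \<sigma>(2) by linarith+
          then have "\<kappa> (Dm u) \<ge> 3 * d / 4" "\<kappa> (Dm v) \<le> d / 4"
            using d unfolding \<kappa>_def by linarith+
          moreover have "d / 2 * \<beta> u \<le> d / 2" using \<beta>[of u] d by (auto intro: mult_left_le)
          ultimately show ?thesis by simp
        qed
        moreover have "\<kappa> (Dm u) \<le> \<kappa> (D u) + \<sigma>"
          using \<kappa>(4)[of "Dm u" "D u"] near[OF True] by simp
        moreover have "\<kappa> (D u) \<le> f u + 2 * d * (1 - \<eta> u)"
        proof -
          have "(1 - \<eta> u) * \<kappa> (D u) \<le> (1 - \<eta> u) * (2 * d)"
            using \<eta>[of u] \<kappa> by (intro mult_left_mono) auto
          then show ?thesis using u by (simp add: f_def algebra_simps)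
        qed
        ultimately show ?thesis using fv by (simp add: G_def u_def)
      next
        \<comment> \<open>This covers values of \<open>F\<close> on the unit sphere: with
          \<open>\<eta> u = 0\<close> the cutoff term alone contributes \<open>2 * d\<close>, which
          dominates \<open>f v\<close>.\<close>
        case False
        then have "\<eta> u = 0" "\<beta> u = 0"
          using \<eta>(3)[of u] \<beta>(3)[of u] in_r0[of u] r by auto
        then show ?thesis using f(1)[of u] f(2)[of v] \<sigma>(1) by (simp add: G_def u_def)
      qed
    qed
    have intGFT: "integrable spherical_uniform (\<lambda>v. G (F (T v)))"
      by (rule U.integrable_const_bound[of _ "5 * d"]) (auto simp: bG)
    have "integral\<^sup>L spherical_uniform f \<le> integral\<^sup>L spherical_uniform (\<lambda>v. G (F (T v)) + 2 * \<sigma>)"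
    proof (rule integral_mono_AE[OF bint[OF contf, of "2 * d"]])
      show "AE v in spherical_uniform. f v \<le> G (F (T v)) + 2 * \<sigma>"
        using T(3) by eventually_elim (use key in blast)
    qed (use f intGFT in auto)
    also have "\<dots> = integral\<^sup>L spherical_uniform (\<lambda>v. G (F (T v))) + 2 * \<sigma>"
      using intGFT U.prob_space by simp
    also have "integral\<^sup>L spherical_uniform (\<lambda>v. G (F (T v))) = integral\<^sup>L (\<mu> m) (\<lambda>y. G (F y))"
      unfolding T(2)[symmetric] by (subst integral_distr) auto
    finally show ?case .
  qed
  \<comment> \<open>Continuity of \<open>F\<close> makes \<open>G\<close> composed with
    \<open>F\<close> an admissible test function; the push-forward then returns the limit to the
    spherical uniform law, where \<open>f\<close> cancels.\<close>
  have "(\<lambda>m. integral\<^sup>L (\<mu> m) (\<lambda>y. G (F y))) \<longlonglongrightarrow> integral\<^sup>L P (\<lambda>y. G (F y))"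
  proof -
    have "continuous_on UNIV (\<lambda>y. G (F y))"
      by (rule continuous_on_compose2[OF contG contF]) auto
    moreover have "bounded (range (\<lambda>y. G (F y)))"
      by (rule boundedI[of _ "5 * d"]) (use bG in auto)
    ultimately show ?thesis using conv by (simp add: converges_weakly_def)
  qed
  also have "integral\<^sup>L P (\<lambda>y. G (F y)) = integral\<^sup>L spherical_uniform G"
    unfolding F_def
    by (rule center_outward_df_pushforward[OF P cont borel_measurable_continuous_onI[OF contG]])
  finally have "(\<lambda>m. integral\<^sup>L (\<mu> m) (\<lambda>y. G (F y)) + 2 * \<sigma>) \<longlonglongrightarrow> integral\<^sup>L spherical_uniform G + 2 * \<sigma>"
    by (intro tendsto_intros)
  then have "integral\<^sup>L spherical_uniform f \<le> integral\<^sup>L spherical_uniform G + 2 * \<sigma>"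
    using ev by (rule tendsto_lowerbound) simp
  also have "integral\<^sup>L spherical_uniform G =
      integral\<^sup>L spherical_uniform f + 2 * d * integral\<^sup>L spherical_uniform (\<lambda>u. 1 - \<eta> u) - d / 2 * b"
  proof -
    have 1: "integrable spherical_uniform f" by (rule bint[OF contf, of "2 * d"]) (use f in auto)
    have 2: "integrable spherical_uniform (\<lambda>u. 1 - \<eta> u)"
      by (rule bint[of _ 1]) (use \<eta> cont\<eta> in \<open>auto intro!: continuous_intros\<close>)
    have 3: "integrable spherical_uniform \<beta>" by (rule int\<beta>) (use \<beta> in auto)
    show ?thesis
      unfolding G_def b_def using 1 2 3 by simp
  qed
  finally have "0 \<le> 2 * d * integral\<^sup>L spherical_uniform (\<lambda>u. 1 - \<eta> u) - d / 2 * b + 2 * \<sigma>"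
    by simp
  moreover have "2 * d * integral\<^sup>L spherical_uniform (\<lambda>u. 1 - \<eta> u) < 2 * d * (b / 8)"
    using j(1) d unfolding \<eta>_def by (intro mult_strict_left_mono) auto
  moreover have "d * b > 0" using d b by simp
  ultimately show False using \<sigma>(3) by simp
qed

section \<open>Uniform convergence\<close>

text \<open>Convexity gives \<open>f (t *\<^sub>R u) \<le> t * f u\<close> for \<open>t \<in> {0..1}\<close>, so up to
  a factor \<open>1 / t\<close> the supremum may be taken over \<open>cball 0 t\<close>, where the convergence is uniform.\<close>

lemma ball_conjugate_tendsto:
  fixes f :: "nat \<Rightarrow> 'a::euclidean_space \<Rightarrow> real"
  assumes lip: "\<And>r. r < 1 \<Longrightarrow> \<exists>L. \<forall>m. L-lipschitz_on (cball 0 r) (f m)"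
    and convex: "\<And>m. convex_on (ball 0 1) (f m)" and zero: "\<And>m. f m 0 = 0"
    and lim: "\<And>u. u \<in> ball 0 1 \<Longrightarrow> (\<lambda>m. f m u) \<longlonglongrightarrow> k u"
    and sub_f: "\<And>m. \<forall>u\<in>ball 0 1. subgrad (ball 0 1) (f m) u \<noteq> {}"
    and sub_k: "\<forall>u\<in>ball 0 1. subgrad (ball 0 1) k u \<noteq> {}"
  shows "(\<lambda>m. ball_conjugate (f m) x) \<longlonglongrightarrow> ball_conjugate k x"
proof (rule order_tendstoI)
  fix c assume "c < ball_conjugate k x"
  \<comment> \<open>For the lower bound one nearly optimal \<open>u\<close> suffices, as
    \<open>f m u\<close> converges there.\<close>
  then obtain u where u: "u \<in> ball 0 1" "c < x \<bullet> u - k u"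
    unfolding ball_conjugate_def using less_cSUP_iff[OF _ ball_conjugate_bdd[OF sub_k]] by fastforce
  have "(\<lambda>m. x \<bullet> u - f m u) \<longlonglongrightarrow> x \<bullet> u - k u"
    by (intro tendsto_intros lim u)
  then have "\<forall>\<^sub>F m in sequentially. c < x \<bullet> u - f m u"
    using u(2) by (rule order_tendstoD)
  then show "\<forall>\<^sub>F m in sequentially. c < ball_conjugate (f m) x"
    by eventually_elim (erule less_le_trans[OF _ ball_conjugate_ge[OF sub_f u(1)]])
next
  fix c assume c: "ball_conjugate k x < c"
  have "k 0 = 0" using LIMSEQ_unique[OF lim[of 0]] zero by simp
  then have pos: "0 \<le> ball_conjugate k x" using ball_conjugate_ge[OF sub_k, of 0 x] by simp
  define c' where "c' = (ball_conjugate k x + c) / 2"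
  have c': "ball_conjugate k x < c'" "c' < c" "c' > 0" using c pos by (auto simp: c'_def)
  \<comment> \<open>Midpoint of \<open>ball_conjugate k x / c'\<close> and 1, so that
    \<open>t < 1\<close> while \<open>t * c'\<close> still exceeds
    \<open>ball_conjugate k x\<close>; the excess \<open>e\<close> is the tolerance on
    \<open>cball 0 t\<close>.\<close>
  define t where "t = (1 + ball_conjugate k x / c') / 2"
  have t: "0 < t" "t < 1" using c' pos by (auto simp: t_def field_simps)
  define e where "e = t * c' - ball_conjugate k x"
  have e: "e > 0" using c' by (simp add: e_def t_def field_simps)
  obtain L where L: "\<And>m. L-lipschitz_on (cball 0 t) (f m)" using lip[OF t(2)] by blast
  have "uniform_limit (cball 0 t) f k sequentially"
    by (rule equilipschitz_uniform_limit[OF compact_cball L lim]) (use t in auto)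
  then have "\<forall>\<^sub>F m in sequentially. \<forall>u\<in>cball 0 t. dist (f m u) (k u) < e"
    using e by (auto simp: uniform_limit_iff)
  then show "\<forall>\<^sub>F m in sequentially. ball_conjugate (f m) x < c"
  proof eventually_elim
    case (elim m)
    have "ball_conjugate (f m) x \<le> c'"
    proof (rule ball_conjugate_le[OF sub_f])
      fix u :: 'a assume u: "u \<in> ball 0 1"
      have tu: "t *\<^sub>R u \<in> cball 0 t" using u t by (auto intro: mult_left_le)
      have tu': "t *\<^sub>R u \<in> ball 0 1" by (rule subsetD[OF _ tu]) (use t in auto)
      have "f m (t *\<^sub>R u) \<le> t * f m u"
        using convex_onD[OF convex, of t 0 u m] t u zero by simp
      then have "t * (x \<bullet> u - f m u) \<le> x \<bullet> (t *\<^sub>R u) - f m (t *\<^sub>R u)"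
        by (simp add: algebra_simps)
      also have "\<dots> \<le> x \<bullet> (t *\<^sub>R u) - k (t *\<^sub>R u) + e"
        using bspec[OF elim tu] by (simp add: dist_real_def)
      also have "\<dots> \<le> t * c'"
        using ball_conjugate_ge[OF sub_k tu', of x] by (simp add: e_def)
      finally show "x \<bullet> u - f m u \<le> c'" using t by simp
    qed
    then show ?case using c'(2) by simp
  qed
qed

text \<open>Compactness supplies a limit \<open>k\<close>; common subgradients leave only an
  additive constant, fixed by the normalisation at \<open>0\<close>. A subsequence is enough for the
  later argument by contradiction.\<close>

lemma potentials_tendsto_subseq:
  fixes P :: "'a::euclidean_space measure"
  assumes \<mu>: "\<And>m. prob_space (\<mu> m)" "\<And>m. sets (\<mu> m) = sets borel"
    and P: "prob_space P" "sets P = sets borel" "center_outward_potential P \<psi>"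
    and conv: "converges_weakly \<mu> P" and pot: "\<And>m. center_outward_potential (\<mu> m) (\<psi>' m)"
    and cont: "continuous_center_outward_df \<psi>"
  obtains s where "strict_mono (s :: nat \<Rightarrow> nat)" "\<And>u. u \<in> ball 0 1 \<Longrightarrow> (\<lambda>m. \<psi>' (s m) u) \<longlonglongrightarrow> \<psi> u"
proof -
  note lip = potentials_equilipschitz[OF \<mu> P(1,2) conv pot]
  have zero: "\<psi>' m 0 = 0" "\<psi> 0 = 0" for m
    using pot[of m] P(3) by (auto simp: center_outward_potential_def)
  obtain k s where s: "strict_mono (s :: nat \<Rightarrow> nat)"
    and k: "\<And>u. u \<in> ball 0 1 \<Longrightarrow> (\<lambda>m. \<psi>' (s m) u) \<longlonglongrightarrow> k u"
    using equilipschitz_convergent_subseq[of \<psi>', OF lip zero(1)] by metis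
  have conv': "converges_weakly (\<lambda>m. \<mu> (s m)) P"
    using conv LIMSEQ_subseq_LIMSEQ[OF _ s] unfolding converges_weakly_def o_def by fast
  have "subgrad (ball 0 1) \<psi> u \<inter> subgrad (ball 0 1) k u \<noteq> {}" if "u \<in> ball 0 1" for u
    by (rule common_subgrad_of_limit[OF \<mu> P conv' pot cont k that])
  then have "k u - \<psi> u = k 0 - \<psi> 0" if "u \<in> ball 0 1" for u
    by (intro common_subgrad_diff_const[of "ball 0 1"]) (use that in auto)
  moreover have "k 0 = 0" using LIMSEQ_unique[OF k[of 0]] zero by simp
  ultimately have "k u = \<psi> u" if "u \<in> ball 0 1" for u using that zero by simp
  with s k show ?thesis using that by metis
qed

text \<open>Almost every \<open>u\<close> is the image of \<open>T u\<close>, so the image meets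
  every nonempty open subset of the ball. It supplies the base points used at infinity.\<close>

lemma center_outward_df_dense:
  fixes P :: "'a::euclidean_space measure"
  assumes P: "prob_space P" "sets P = sets borel" "center_outward_potential P \<psi>"
    and cont: "continuous_center_outward_df \<psi>" and V: "open V" "V \<noteq> {}" "V \<subseteq> ball 0 1"
  obtains y where "the_elem (center_outward_df \<psi> y) \<in> V"
proof -
  note nonempty = potential_subgrad_nonempty[OF P]
  obtain T where T: "AE u in spherical_uniform. u \<in> ball 0 1 \<and> T u \<in> subgrad (ball 0 1) \<psi> u"
    using center_outward_potential_subgrad[OF P(3)] .
  obtain u where u: "u \<in> V" "u \<in> ball 0 1" "T u \<in> subgrad (ball 0 1) \<psi> u"
    using AE_spherical_uniform_dense[OF T V] by blast
  have "the_elem (center_outward_df \<psi> (T u)) = u"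
    by (rule the_elem_center_outward_df_iff[OF nonempty cont, THEN iffD2, OF subgrad_ball_conjugateI[OF nonempty u(2,3)]])
  with u(1) show ?thesis by (intro that[of "T u"]) simp
qed

text \<open>Monotonicity against fixed base points \<open>y\<close>, whose images are dense in the ball.\<close>

lemma subgrad_at_infinity:
  fixes h :: "nat \<Rightarrow> 'a::euclidean_space \<Rightarrow> 'a"
  assumes sub: "\<And>n y. h n y \<in> subgrad UNIV (\<phi> n) y" and le: "\<And>n y. norm (h n y) \<le> 1"
    and lim: "\<And>y. (\<lambda>n. h n y) \<longlonglongrightarrow> F y"
    and dense: "\<And>V. open V \<Longrightarrow> V \<noteq> {} \<Longrightarrow> V \<subseteq> ball 0 1 \<Longrightarrow> \<exists>y. F y \<in> V"
    and z: "filterlim (\<lambda>n. norm (z n)) at_top sequentially" and e: "(\<lambda>n. sgn (z n)) \<longlonglongrightarrow> e"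
  shows "(\<lambda>n. h n (z n)) \<longlonglongrightarrow> e"
proof -
  have ne: "\<forall>\<^sub>F n in sequentially. norm (z n) > 0"
    using z unfolding filterlim_at_top_dense by blast
  have "(\<lambda>n. norm (sgn (z n))) \<longlonglongrightarrow> 1"
    by (rule tendsto_eventually, use ne in eventually_elim) (simp add: norm_sgn)
  then have e1: "norm e = 1"
    using LIMSEQ_unique tendsto_norm[OF e] by blast
  \<comment> \<open>Both vectors have norm at most 1, so their squared distance is at most
    \<open>2 - 2 * (h n (z n) \<bullet> sgn (z n))\<close>, and the inner product decides
    convergence.\<close>
  have "(\<lambda>n. h n (z n) \<bullet> sgn (z n)) \<longlonglongrightarrow> 1"
  proof (rule order_tendstoI)
    fix c :: real assume c: "c < 1"
    have "e \<in> closure (ball 0 1)" using e1 by simp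
    then obtain v where v: "v \<in> ball 0 1" "dist v e < 1 - c"
      using c closure_approachable[of e "ball 0 1"] by (metis diff_gt_0_iff_gt)
    have "open (ball 0 1 \<inter> ball e (1 - c))" "ball 0 1 \<inter> ball e (1 - c) \<noteq> {}"
      using v by (auto simp: dist_commute)
    then obtain y where y: "F y \<in> ball e (1 - c)" using dense[of "ball 0 1 \<inter> ball e (1 - c)"] by auto
    have "(e - F y) \<bullet> e \<le> norm (e - F y) * norm e" by (rule norm_cauchy_schwarz)
    then have Fe: "c < F y \<bullet> e"
      using y e1 by (simp add: dist_norm inner_diff_left power2_norm_eq_inner[symmetric])
    have "(\<lambda>n. h n y \<bullet> sgn (z n) - 2 * norm y / norm (z n)) \<longlonglongrightarrow> F y \<bullet> e - 0"
      by (intro tendsto_intros lim e tendsto_divide_0[OF tendsto_const] filterlim_at_top_imp_at_infinity z)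
    then have "\<forall>\<^sub>F n in sequentially. c < h n y \<bullet> sgn (z n) - 2 * norm y / norm (z n)"
      by (rule order_tendstoD(1)) (use Fe in simp)
    then show "\<forall>\<^sub>F n in sequentially. c < h n (z n) \<bullet> sgn (z n)"
      using ne
    proof eventually_elim
      case (elim n)
      \<comment> \<open>Monotonicity between \<open>y\<close> and \<open>z n\<close>; the terms
        involving \<open>y\<close> are bounded by \<open>2 * norm y\<close> and vanish after
        division by \<open>norm (z n)\<close>.\<close>
      have "0 \<le> (h n (z n) - h n y) \<bullet> (z n - y)"
        using subgradD[OF sub[of n y], of "z n"] subgradD[OF sub[of n "z n"], of y]
        by (simp add: inner_diff_left inner_diff_right)
      moreover have "(h n y - h n (z n)) \<bullet> y \<le> 2 * norm y"
      proof -
        have "(h n y - h n (z n)) \<bullet> y \<le> norm (h n y - h n (z n)) * norm y" by (rule norm_cauchy_schwarz)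
        also have "\<dots> \<le> 2 * norm y"
          using norm_triangle_ineq4[of "h n y" "h n (z n)"] le[of n y] le[of n "z n"]
          by (intro mult_right_mono) auto
        finally show ?thesis .
      qed
      moreover have "- ((h n y - h n (z n)) \<bullet> y) \<le> 2 * norm y"
      proof -
        have "(h n y - h n (z n)) \<bullet> (- y) \<le> norm (h n y - h n (z n)) * norm (- y)" by (rule norm_cauchy_schwarz)
        also have "\<dots> \<le> 2 * norm (- y)"
          using norm_triangle_ineq4[of "h n y" "h n (z n)"] le[of n y] le[of n "z n"]
          by (intro mult_right_mono) auto
        finally show ?thesis by simp
      qed
      ultimately have "h n y \<bullet> z n - 2 * norm y \<le> h n (z n) \<bullet> z n"
        by (simp add: inner_diff_left inner_diff_right)
      then have "(h n y \<bullet> z n - 2 * norm y) / norm (z n) \<le> (h n (z n) \<bullet> z n) / norm (z n)"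
        by (intro divide_right_mono) auto
      then have "h n y \<bullet> sgn (z n) - 2 * norm y / norm (z n) \<le> h n (z n) \<bullet> sgn (z n)"
        by (simp add: sgn_div_norm diff_divide_distrib divide_inverse algebra_simps)
      then show ?case using elim by simp
    qed
  next
    fix c :: real assume c: "1 < c"
    have "h n (z n) \<bullet> sgn (z n) < c" for n
    proof -
      have "h n (z n) \<bullet> sgn (z n) \<le> norm (h n (z n)) * norm (sgn (z n))" by (rule norm_cauchy_schwarz)
      also have "\<dots> \<le> 1 * 1" by (intro mult_mono le) (auto simp: norm_sgn)
      finally show ?thesis using c by simp
    qed
    then show "\<forall>\<^sub>F n in sequentially. h n (z n) \<bullet> sgn (z n) < c" by simp
  qed
  then have "(\<lambda>n. sqrt (2 - 2 * (h n (z n) \<bullet> sgn (z n)))) \<longlonglongrightarrow> sqrt (2 - 2 * 1)"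
    by (intro tendsto_intros)
  then have "(\<lambda>n. sqrt (2 - 2 * (h n (z n) \<bullet> sgn (z n)))) \<longlonglongrightarrow> 0" by simp
  moreover have "norm (h n (z n) - sgn (z n)) \<le> sqrt (2 - 2 * (h n (z n) \<bullet> sgn (z n)))" for n
  proof (rule real_le_rsqrt)
    have "(norm (h n (z n)))\<^sup>2 \<le> 1" "(norm (sgn (z n)))\<^sup>2 \<le> 1"
      by (auto intro!: power_le_one le simp: norm_sgn)
    then show "(norm (h n (z n) - sgn (z n)))\<^sup>2 \<le> 2 - 2 * (h n (z n) \<bullet> sgn (z n))"
      by (simp add: power2_norm_eq_inner inner_diff_left inner_diff_right inner_commute)
  qed
  ultimately have "(\<lambda>n. h n (z n) - sgn (z n)) \<longlonglongrightarrow> 0"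
    by (intro Lim_null_comparison[of "\<lambda>n. h n (z n) - sgn (z n)"]) auto
  from tendsto_add[OF this e] show ?thesis by simp
qed

theorem theorem3p2:
  fixes \<mu> :: "nat \<Rightarrow> 'a::euclidean_space measure" and P :: "'a measure"
    and \<psi>\<^sub>m :: "nat \<Rightarrow> 'a \<Rightarrow> real" and \<psi> :: "'a \<Rightarrow> real"
  assumes "\<And>m. prob_space (\<mu> m)" and "\<And>m. sets (\<mu> m) = sets borel"
    and "prob_space P" and "sets P = sets borel"
    and "\<And>m. center_outward_potential (\<mu> m) (\<psi>\<^sub>m m)"
    and "center_outward_potential P \<psi>"
    and "\<And>m. continuous_center_outward_df (\<psi>\<^sub>m m)"
    and "converges_weakly \<mu> P"
    and "continuous_center_outward_df \<psi>"
  shows "(\<lambda>m. SUP x. norm (the_elem (center_outward_df (\<psi>\<^sub>m m) x) - the_elem (center_outward_df \<psi> x)))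
           \<longlonglongrightarrow> 0"
proof -
  define F where "F x = the_elem (center_outward_df \<psi> x)" for x
  define H where "H m x = the_elem (center_outward_df (\<psi>\<^sub>m m) x)" for m x
  note P = assms(3,4,6) and cont = assms(9)
  note ne = potential_subgrad_nonempty[OF P]
  note nem = potential_subgrad_nonempty[OF assms(1,2,5)]
  have F: "F y \<in> subgrad UNIV (ball_conjugate \<psi>) y" "norm (F y) \<le> 1"
    "u \<in> subgrad UNIV (ball_conjugate \<psi>) y \<Longrightarrow> u = F y" for u y
    unfolding F_def using the_elem_center_outward_df_iff[OF ne cont]
      norm_the_elem_center_outward_df_le[OF ne cont] by metis+
  have H: "H m y \<in> subgrad UNIV (ball_conjugate (\<psi>\<^sub>m m)) y" "norm (H m y) \<le> 1" for m y
    unfolding H_def using the_elem_center_outward_df_iff[OF nem assms(7)]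
      norm_the_elem_center_outward_df_le[OF nem assms(7)] by metis+
  have contF: "continuous_on UNIV F"
    unfolding F_def by (rule continuous_the_elem_center_outward_df[OF ne cont])
  have dense: "\<exists>y. F y \<in> V" if "open V" "V \<noteq> {}" "V \<subseteq> ball 0 1" for V
    unfolding F_def using center_outward_df_dense[OF P cont that] by blast
  have uniform: "\<forall>\<^sub>F m in sequentially. \<forall>x. norm (H m x - F x) < e" if e: "e > 0" for e
  proof (rule ccontr)
    assume "\<not> ?thesis"
    then have "\<exists>\<^sub>F m in sequentially. \<exists>x. e \<le> norm (H m x - F x)"
      by (simp add: not_eventually not_less)
    then have "infinite {m. \<exists>x. e \<le> norm (H m x - F x)}"
      by (simp add: frequently_cofinite[symmetric] cofinite_eq_sequentially)
    then obtain s :: "nat \<Rightarrow> nat" where s: "strict_mono s" "\<And>n. \<exists>x. e \<le> norm (H (s n) x - F x)"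
      using infinite_enumerate[of "{m. \<exists>x. e \<le> norm (H m x - F x)}"] by auto
    then obtain x where x: "\<And>n. e \<le> norm (H (s n) (x n) - F (x n))" by metis
    have conv: "converges_weakly (\<lambda>n. \<mu> (s n)) P"
      using assms(8) LIMSEQ_subseq_LIMSEQ[OF _ s(1)] unfolding converges_weakly_def o_def by fast
    obtain t where t: "strict_mono t" "\<And>u. u \<in> ball 0 1 \<Longrightarrow> (\<lambda>n. \<psi>\<^sub>m (s (t n)) u) \<longlonglongrightarrow> \<psi> u"
      using potentials_tendsto_subseq[of "\<lambda>n. \<mu> (s n)" P \<psi> "\<lambda>n. \<psi>\<^sub>m (s n)", OF assms(1,2) P conv assms(5) cont]
      by metis
    define r where "r n = s (t n)" for n
    define z where "z n = x (t n)" for n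
    have z: "e \<le> norm (H (r n) (z n) - F (z n))" for n using x by (simp add: r_def z_def)
    have conj: "(\<lambda>n. ball_conjugate (\<psi>\<^sub>m (r n)) y) \<longlonglongrightarrow> ball_conjugate \<psi> y" for y
    proof (rule ball_conjugate_tendsto[OF _ _ _ _ nem ne])
      show "\<exists>L. \<forall>m. L-lipschitz_on (cball 0 q) (\<psi>\<^sub>m (r m))" if "q < 1" for q
        using potentials_equilipschitz[OF assms(1-4,8,5) that] by blast
      show "convex_on (ball 0 1) (\<psi>\<^sub>m (r m))" "\<psi>\<^sub>m (r m) 0 = 0" for m
        using assms(5)[of "r m"] by (auto simp: center_outward_potential_def)
    qed (use t(2) in \<open>simp add: r_def\<close>)
    \<comment> \<open>The discrepancy at the points \<open>z n\<close> never drops below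
      \<open>e\<close>, so \<open>H\<close> and \<open>F\<close> cannot share a limit along any
      subsequence of them.\<close>
    have contradiction: False if q: "strict_mono q" and g: "(\<lambda>n. H (r (q n)) (z (q n))) \<longlonglongrightarrow> g"
      and "(\<lambda>n. F (z (q n))) \<longlonglongrightarrow> g" for q g
    proof -
      have "(\<lambda>n. norm (H (r (q n)) (z (q n)) - F (z (q n)))) \<longlonglongrightarrow> norm (g - g)"
        using that by (intro tendsto_intros)
      then have "e \<le> norm (g - g)"
        by (rule LIMSEQ_le_const) (use z in auto)
      then show False using e by simp
    qed
    have conj_subseq: "(\<lambda>n. ball_conjugate (\<psi>\<^sub>m (r (q n))) y) \<longlonglongrightarrow> ball_conjugate \<psi> y" if "strict_mono q" for q y
      using LIMSEQ_subseq_LIMSEQ[OF conj that] by (simp add: o_def)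
    have H_tendsto: "(\<lambda>n. H (r (q n)) (w n)) \<longlonglongrightarrow> F y" if q: "strict_mono q" and w: "w \<longlonglongrightarrow> y" for q w y
      by (rule subgrad_tendsto[OF ball_conjugate_lipschitz[OF nem] conj_subseq[OF q] w H(1) F(3)])
    show False
    \<comment> \<open>Either the points escape to infinity, and a subsequence of their directions
      converges, or infinitely many stay bounded, and a subsequence of the points converges.\<close>
    proof (cases "filterlim (\<lambda>n. norm (z n)) at_top sequentially")
      case True
      have "sgn (z n) \<in> cball 0 1" for n by (simp add: norm_sgn)
      then obtain q c where q: "strict_mono q" "((\<lambda>n. sgn (z n)) \<circ> q) \<longlonglongrightarrow> c"
        using compact_cball[of "0::'a" 1] unfolding compact_def by metis
      have inf: "filterlim (\<lambda>n. norm (z (q n))) at_top sequentially"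
        using filterlim_compose[OF True filterlim_subseq[OF q(1)]] .
      have c: "(\<lambda>n. sgn (z (q n))) \<longlonglongrightarrow> c" using q(2) by (simp add: o_def)
      have "(\<lambda>n. H (r (q n)) (z (q n))) \<longlonglongrightarrow> c"
        by (rule subgrad_at_infinity[OF H H_tendsto[OF q(1) tendsto_const] dense inf c])
      \<comment> \<open>The same lemma for the constant sequence \<open>F\<close> gives the same
        limit direction.\<close>
      moreover have "(\<lambda>n. F (z (q n))) \<longlonglongrightarrow> c"
        by (rule subgrad_at_infinity[where h="\<lambda>n. F", OF F(1,2) tendsto_const dense inf c])
      ultimately show False by (rule contradiction[OF q(1)])
    next
      case False
      then obtain K where "\<not> (\<forall>\<^sub>F n in sequentially. K \<le> norm (z n))"
        by (auto simp: filterlim_at_top)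
      then have "\<exists>\<^sub>F n in sequentially. norm (z n) \<le> K"
        by (rule not_eventually[THEN iffD1, THEN frequently_elim1]) simp
      then have "infinite {n. norm (z n) \<le> K}"
        by (simp add: frequently_cofinite[symmetric] cofinite_eq_sequentially)
      then obtain p :: "nat \<Rightarrow> nat" where p: "strict_mono p" "\<And>n. norm (z (p n)) \<le> K"
        using infinite_enumerate[of "{n. norm (z n) \<le> K}"] by auto
      then have "(z \<circ> p) n \<in> cball 0 K" for n by simp
      then obtain q y where q: "strict_mono q" "(z \<circ> p \<circ> q) \<longlonglongrightarrow> y"
        using compact_cball[of "0::'a" K] unfolding compact_def by metis
      have pq: "strict_mono (\<lambda>n. p (q n))"
        using strict_mono_o[OF p(1) q(1)] by (simp add: o_def)
      have zy: "(\<lambda>n. z (p (q n))) \<longlonglongrightarrow> y" using q(2) by (simp add: o_def)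
      have "isCont F y" using contF by (simp add: continuous_on_eq_continuous_at)
      then have "(\<lambda>n. F (z (p (q n)))) \<longlonglongrightarrow> F y"
        using zy by (rule isCont_tendsto_compose)
      then show False
        by (rule contradiction[OF pq H_tendsto[OF pq zy]])
    qed
  qed
  \<comment> \<open>A real supremum obeys its order laws only for sets bounded above; two vectors of
    norm at most 1 differ by at most 2.\<close>
  have bdd: "bdd_above (range (\<lambda>x. norm (H m x - F x)))" for m
  proof (rule bdd_aboveI2[of _ _ 2])
    show "norm (H m x - F x) \<le> 2" for x
      using norm_triangle_ineq4[of "H m x" "F x"] H(2)[of m x] F(2)[of x] by linarith
  qed
  have "(\<lambda>m. SUP x. norm (H m x - F x)) \<longlonglongrightarrow> 0"
  proof (rule tendstoI)
    fix e :: real assume e: "e > 0"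
    \<comment> \<open>The supremum preserves only a weak inequality, hence the target
      \<open>e / 2\<close>.\<close>
    have "\<forall>\<^sub>F m in sequentially. \<forall>x. norm (H m x - F x) < e / 2" by (rule uniform) (use e in simp)
    then show "\<forall>\<^sub>F m in sequentially. dist (SUP x. norm (H m x - F x)) 0 < e"
    proof eventually_elim
      case (elim m)
      have "0 \<le> norm (H m 0 - F 0)" by simp
      also have "\<dots> \<le> (SUP x. norm (H m x - F x))" by (rule cSUP_upper[OF UNIV_I bdd])
      finally have "0 \<le> (SUP x. norm (H m x - F x))" .
      moreover have "(SUP x. norm (H m x - F x)) \<le> e / 2"
        by (rule cSUP_least) (use elim in \<open>auto intro: less_imp_le\<close>)
      ultimately show ?case using e by (simp add: dist_real_def)
    qed
  qed
  then show ?thesis by (simp add: H_def F_def)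
qed

end
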